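(* For $C\in\mathbb{R}$ let $$A_3^C=\{(x,y,z,u,v)\in\mathbb{R}^5 : x+y+z+u+v=0,\ x^2+y^2+z^2+u^2+v^2=1,\ x^3+y^3+z^3+u^3+v^3=C\}.$$ If $C\in\left(\frac{1}{\sqrt{30}},\frac{3}{\sqrt{20}}\right)\cup\left(-\frac{3}{\sqrt{20}},-\frac{1}{\sqrt{30}}\right)$, then $A_3^C$ is the disjoint union of $5$ two-dimensional spheres. If $C=\pm\frac{1}{\sqrt{30}}$, then $A_3^C$ is the union of $5$ two-dimensional spheres which mutually intersect at one point (any two of them meet in exactly one point), having $\binom{5}{2}=10$ singular points.
   Context: In the first case $A_3^C$ is a smooth submanifold of $\mathbb{R}^5$ and "is the disjoint union of spheres" is understood up to diffeomorphism. In the second case "sphere" means a subset homeomorphic to the two-dimensional sphere $S^2$. A point of $A_3^C$ is singular if the differentials of $x+y+z+u+v$, $x^2+y^2+z^2+u^2+v^2$ and $x^3+y^3+z^3+u^3+v^3$ are linearly dependent at it (equivalently, its coordinates take fewer than three distinct values). *)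

theory Defs
  imports "HOL-Analysis.Analysis"
begin

primrec C_k_on :: "nat \<Rightarrow> 'a::euclidean_space set \<Rightarrow> ('a \<Rightarrow> 'b::euclidean_space) \<Rightarrow> bool" where
  "C_k_on 0 U f \<longleftrightarrow> continuous_on U f"
| "C_k_on (Suc k) U f \<longleftrightarrow>
     (\<forall>x\<in>U. f differentiable (at x)) \<and>
     (\<forall>v. C_k_on k U (\<lambda>x. frechet_derivative f (at x) v))"

(* Only meant for open U: the derivatives are taken in the full space. *)
definition C_infinity_on :: "'a::euclidean_space set \<Rightarrow> ('a \<Rightarrow> 'b::euclidean_space) \<Rightarrow> bool" where
  "C_infinity_on U f \<longleftrightarrow> (\<forall>k. C_k_on k U f)"

(* Smooth maps, diffeomorphisms and submanifolds for arbitrary subsets of Euclidean spaces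
   follow Milnor, "Topology from the Differentiable Viewpoint", Section 1. *)

definition smooth_on :: "'a::euclidean_space set \<Rightarrow> ('a \<Rightarrow> 'b::euclidean_space) \<Rightarrow> bool" where
  "smooth_on X f \<longleftrightarrow>
     (\<forall>x\<in>X. \<exists>U g. open U \<and> x \<in> U \<and> C_infinity_on U g \<and> (\<forall>y\<in>X \<inter> U. g y = f y))"

definition diffeomorphic :: "'a::euclidean_space set \<Rightarrow> 'b::euclidean_space set \<Rightarrow> bool" where
  "diffeomorphic X Y \<longleftrightarrow>
     (\<exists>f g. smooth_on X f \<and> smooth_on Y g \<and> f ` X = Y \<and> g ` Y = X \<and>
            (\<forall>x\<in>X. g (f x) = x) \<and> (\<forall>y\<in>Y. f (g y) = y))"

(* The first argument is the model space, so DIM('m) is the dimension of M. *)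
definition smooth_submanifold ::
    "'m::euclidean_space itself \<Rightarrow> 'a::euclidean_space set \<Rightarrow> bool" where
  "smooth_submanifold TYPE('m) M \<longleftrightarrow>
     (\<forall>p\<in>M. \<exists>W (U :: 'm set). openin (top_of_set M) W \<and> p \<in> W \<and> open U \<and> diffeomorphic W U)"

definition power_sum :: "nat \<Rightarrow> real ^ 5 \<Rightarrow> real" where
  "power_sum k x = (\<Sum>i\<in>UNIV. (x $ i) ^ k)"

definition A3 :: "real \<Rightarrow> (real ^ 5) set" where
  "A3 C = {x. power_sum 1 x = 0 \<and> power_sum 2 x = 1 \<and> power_sum 3 x = C}"

(* Linear dependence of the differentials as a family: coinciding differentials count
   as dependent, which "dependent" on the set of the three would not give. *)
definition singular_points :: "real \<Rightarrow> (real ^ 5) set" where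
  "singular_points C =
     {p \<in> A3 C. \<exists>a b c :: real. (a, b, c) \<noteq> (0, 0, 0) \<and>
        (\<forall>h. a * frechet_derivative (power_sum 1) (at p) h
            + b * frechet_derivative (power_sum 2) (at p) h
            + c * frechet_derivative (power_sum 3) (at p) h = 0)}"

end

(* With c = 1 / sqrt 30, summing (t - 3c) (t + 2c)^2 over the coordinates t of a point of A3 C
   gives C - c; so for C >= c some coordinate is at least 3c.  If the coordinates i and j of x are
   both at least 3c, the squared distance from x to the point p with entries 3c at i, j and
   -2c elsewhere is 2 - 10 c (x_i + x_j) <= 0, so x = p.  Hence the five sets {x_i >= 3c} cover A3 C;
   they are disjoint for C > c, and for C = c any two of them share exactly one point.

   The i-th set is a sphere because it meets each half great circle from e, the unit vector of
   (4,-1,-1,-1,-1), through y in the unit sphere orthogonal to e exactly once between e and the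
   level x_i = 3c: the cubic power sum is strictly monotone on that arc.  The solution is a smooth
   function of y for C > c by the one-dimensional inverse function theorem.

   At a singular point the multipliers are determined up to scale by the values of the power sums:
   all coordinates are roots of t^2 - C t - 1/5 = (t - 3C) (t + 2C). *)

theory Submission
  imports Defs "HOL-Real_Asymp.Real_Asymp"
begin

section \<open>Smooth maps\<close>

lemma frechet_derivative_cong_open:
  assumes "open U" "x \<in> U" "\<And>y. y \<in> U \<Longrightarrow> f y = g y"
  shows "frechet_derivative f (at x) = frechet_derivative g (at x)"
proof -
  have "(f has_derivative D) (at x) \<longleftrightarrow> (g has_derivative D) (at x)" for D
    using has_derivative_transform_within_open[OF _ assms(1,2)] assms(3) by metis
  then show ?thesis
    by (simp add: frechet_derivative_def)
qed

lemma C_k_on_cong: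
  assumes "open U" "\<And>x. x \<in> U \<Longrightarrow> f x = g x"
  shows "C_k_on k U f \<longleftrightarrow> C_k_on k U g"
  using assms(2)
proof (induction k arbitrary: f g)
  case 0
  then show ?case by (simp cong: continuous_on_cong)
next
  case (Suc k)
  have "f differentiable (at x) \<longleftrightarrow> g differentiable (at x)" if "x \<in> U" for x
    unfolding differentiable_def
    using has_derivative_transform_within_open[OF _ assms(1) that] Suc.prems by metis
  moreover have "C_k_on k U (\<lambda>x. frechet_derivative f (at x) v) =
      C_k_on k U (\<lambda>x. frechet_derivative g (at x) v)" for v
    by (intro Suc.IH) (metis frechet_derivative_cong_open assms(1) Suc.prems)
  ultimately show ?case by simp
qed

text \<open>On an open set the derivative is unique, so any family \<open>D\<close> of derivatives
  may replace the chosen \<open>frechet_derivative\<close>. The later closure rules are proved by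
  exhibiting such a family.\<close>

lemma C_k_on_Suc_iff:
  assumes "open U"
  shows "C_k_on (Suc k) U f \<longleftrightarrow>
    (\<exists>D. (\<forall>x\<in>U. (f has_derivative D x) (at x)) \<and> (\<forall>v. C_k_on k U (\<lambda>x. D x v)))"
proof
  assume "C_k_on (Suc k) U f"
  then show "\<exists>D. (\<forall>x\<in>U. (f has_derivative D x) (at x)) \<and> (\<forall>v. C_k_on k U (\<lambda>x. D x v))"
    by (intro exI[of _ "\<lambda>x. frechet_derivative f (at x)"]) (simp add: frechet_derivative_works)
next
  assume "\<exists>D. (\<forall>x\<in>U. (f has_derivative D x) (at x)) \<and> (\<forall>v. C_k_on k U (\<lambda>x. D x v))"
  then obtain D where D: "\<And>x. x \<in> U \<Longrightarrow> (f has_derivative D x) (at x)"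
    and k: "\<And>v. C_k_on k U (\<lambda>x. D x v)" by blast
  have "C_k_on k U (\<lambda>x. frechet_derivative f (at x) v)" for v
    using k[of v] C_k_on_cong[OF assms, of "\<lambda>x. D x v" "\<lambda>x. frechet_derivative f (at x) v"]
      frechet_derivative_at[OF D] by metis
  then show "C_k_on (Suc k) U f"
    using D by (auto simp: differentiable_def)
qed

lemma C_k_on_SucI:
  assumes "open U" "\<And>x. x \<in> U \<Longrightarrow> (f has_derivative D x) (at x)" "\<And>v. C_k_on k U (\<lambda>x. D x v)"
  shows "C_k_on (Suc k) U f"
  using assms C_k_on_Suc_iff by blast

lemma C_k_on_SucD:
  assumes "C_k_on (Suc k) U f"
  shows "x \<in> U \<Longrightarrow> (f has_derivative frechet_derivative f (at x)) (at x)"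
    "C_k_on k U (\<lambda>x. frechet_derivative f (at x) v)"
  using assms by (auto simp: frechet_derivative_works)

lemma C_k_on_mono: "C_k_on k U f \<Longrightarrow> V \<subseteq> U \<Longrightarrow> C_k_on k V f"
proof (induction k arbitrary: f)
  case 0
  then show ?case using continuous_on_subset by auto
qed auto

lemma C_k_on_Suc_imp: "C_k_on (Suc k) U f \<Longrightarrow> C_k_on k U f"
proof (induction k arbitrary: f)
  case 0
  then show ?case
    by (simp add: continuous_at_imp_continuous_on differentiable_imp_continuous_within)
next
  case (Suc k)
  then show ?case
    by (metis C_k_on.simps(2))
qed

lemma C_k_on_const: "C_k_on k U (\<lambda>x. c)"
  by (induction k arbitrary: c) simp_all

lemma C_k_on_linear:
  assumes "bounded_linear f"
  shows "C_k_on k U f"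
proof (cases k)
  case 0
  then show ?thesis
    using assms by (simp add: linear_continuous_on)
next
  case (Suc n)
  have d: "(f has_derivative f) (at x)" for x
    using assms by (rule bounded_linear_imp_has_derivative)
  then have "frechet_derivative f (at x) = f" for x
    using frechet_derivative_at by metis
  then show ?thesis
    using d Suc by (auto simp: C_k_on_const differentiable_def)
qed

lemma C_k_on_add:
  assumes "open U" "C_k_on k U f" "C_k_on k U g"
  shows "C_k_on k U (\<lambda>x. f x + g x)"
  using assms(2,3)
proof (induction k arbitrary: f g)
  case 0
  then show ?case by (simp add: continuous_on_add)
next
  case (Suc k)
  let ?D = "\<lambda>x. frechet_derivative f (at x)"
  note D = C_k_on_SucD[OF Suc.prems(1)]
  let ?E = "\<lambda>x. frechet_derivative g (at x)"
  note E = C_k_on_SucD[OF Suc.prems(2)]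
  show ?case
    by (rule C_k_on_SucI[OF assms(1), of _ "\<lambda>x v. ?D x v + ?E x v"])
      (auto intro: has_derivative_add D E Suc.IH)
qed

lemma C_k_on_sum:
  assumes "open U" "finite I" "\<And>i. i \<in> I \<Longrightarrow> C_k_on k U (f i)"
  shows "C_k_on k U (\<lambda>x. \<Sum>i\<in>I. f i x)"
  using assms(2,3)
  by (induction I) (auto intro: C_k_on_add assms(1) C_k_on_const)

text \<open>Induction with the product rule; one statement serves scalar multiplication, real
  multiplication and the inner product.\<close>

lemma C_k_on_bilinear:
  assumes "bounded_bilinear B" "open U" "C_k_on k U f" "C_k_on k U g"
  shows "C_k_on k U (\<lambda>x. B (f x) (g x))"
  using assms(3,4)
proof (induction k arbitrary: f g)
  case 0
  then show ?case by (simp add: bounded_bilinear.continuous_on[OF assms(1)])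
next
  case (Suc k)
  let ?D = "\<lambda>x. frechet_derivative f (at x)"
  note D = C_k_on_SucD[OF Suc.prems(1)]
  let ?E = "\<lambda>x. frechet_derivative g (at x)"
  note E = C_k_on_SucD[OF Suc.prems(2)]
  show ?case
  proof (rule C_k_on_SucI[OF assms(2)])
    show "((\<lambda>x. B (f x) (g x)) has_derivative (\<lambda>v. B (f x) (?E x v) + B (?D x v) (g x))) (at x)"
      if "x \<in> U" for x
      using bounded_bilinear.FDERIV[OF assms(1) D(1)[OF that] E(1)[OF that]] .
    show "C_k_on k U (\<lambda>x. B (f x) (?E x v) + B (?D x v) (g x))" for v
      using D E C_k_on_Suc_imp[OF Suc.prems(1)] C_k_on_Suc_imp[OF Suc.prems(2)]
      by (intro C_k_on_add Suc.IH assms(2))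
  qed
qed

lemma C_k_on_compose:
  fixes f :: "'a::euclidean_space \<Rightarrow> 'b::euclidean_space" and g :: "'b \<Rightarrow> 'c::euclidean_space"
  assumes "open U" "open V" "C_k_on k U f" "C_k_on k V g" "f ` U \<subseteq> V"
  shows "C_k_on k U (\<lambda>x. g (f x))"
  using assms(3-5)
proof (induction k arbitrary: f g)
  case 0
  then show ?case by (auto intro: continuous_on_compose2)
next
  case (Suc k)
  let ?D = "\<lambda>x. frechet_derivative f (at x)"
  note D = C_k_on_SucD[OF Suc.prems(1)]
  let ?E = "\<lambda>x. frechet_derivative g (at x)"
  note E = C_k_on_SucD[OF Suc.prems(2)]
  show ?case
  proof (rule C_k_on_SucI[OF assms(1)])
    fix x assume x: "x \<in> U"
    then have fx: "f x \<in> V"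
      using Suc.prems by auto
    have "((\<lambda>x. g (f x)) has_derivative (\<lambda>v. ?E (f x) (?D x v))) (at x)"
      by (rule has_derivative_compose[OF D(1)[OF x] E(1)[OF fx]])
    \<comment> \<open>The direction \<open>?D x v\<close> moves with \<open>x\<close>, whereas the
      induction hypothesis concerns derivatives in a fixed direction. Expanding over the basis
      leaves \<open>?E\<close> evaluated at fixed directions \<open>b\<close> only.\<close>
    moreover have "?E (f x) (?D x v) = (\<Sum>b\<in>Basis. (?D x v \<bullet> b) *\<^sub>R ?E (f x) b)" for v
    proof -
      have lin: "linear (?E (f x))"
        using E(1)[OF fx] has_derivative_linear by blast
      have "?E (f x) (?D x v) = ?E (f x) (\<Sum>b\<in>Basis. (?D x v \<bullet> b) *\<^sub>R b)"
        by (simp only: euclidean_representation)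
      also have "\<dots> = (\<Sum>b\<in>Basis. (?D x v \<bullet> b) *\<^sub>R ?E (f x) b)"
        by (simp add: linear_sum[OF lin] linear_cmul[OF lin])
      finally show ?thesis .
    qed
    ultimately show "((\<lambda>x. g (f x)) has_derivative
        (\<lambda>v. \<Sum>b\<in>Basis. (?D x v \<bullet> b) *\<^sub>R ?E (f x) b)) (at x)" by simp
  next
    fix v
    show "C_k_on k U (\<lambda>x. \<Sum>b\<in>Basis. (?D x v \<bullet> b) *\<^sub>R ?E (f x) b)"
      by (intro C_k_on_sum C_k_on_bilinear[OF bounded_bilinear_scaleR]
          C_k_on_bilinear[OF bounded_bilinear_inner] C_k_on_const D Suc.IH E assms(1)
          C_k_on_Suc_imp[OF Suc.prems(1)] Suc.prems(3)) simp
  qed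
qed

lemma C_k_on_real_SucI:
  fixes f :: "real \<Rightarrow> real"
  assumes "open U" "\<And>x. x \<in> U \<Longrightarrow> (f has_real_derivative f' x) (at x)" "C_k_on k U f'"
  shows "C_k_on (Suc k) U f"
proof (rule C_k_on_SucI[OF assms(1)])
  show "(f has_derivative (\<lambda>v. f' x * v)) (at x)" if "x \<in> U" for x
    using assms(2)[OF that] by (simp add: has_field_derivative_def)
  show "C_k_on k U (\<lambda>x. f' x * v)" for v
    by (rule C_k_on_bilinear[OF bounded_bilinear_mult assms(1,3) C_k_on_const])
qed

text \<open>Bootstrapping: the derivative is a product of constants and copies of the function
  itself, so regularity rises by one order at each step.\<close>

lemma C_k_on_inverse: "C_k_on k (- {0}) (inverse :: real \<Rightarrow> real)"
proof (induction k)
  case 0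
  show ?case by (auto intro!: continuous_intros)
next
  case (Suc k)
  have o: "open (- {0 :: real})" by auto
  show ?case
  proof (rule C_k_on_real_SucI[OF o])
    show "(inverse has_real_derivative (- 1 * (inverse x * inverse x))) (at x)" if "x \<in> - {0}" for x :: real
      using that by (auto intro!: derivative_eq_intros)
    show "C_k_on k (- {0}) (\<lambda>x :: real. - 1 * (inverse x * inverse x))"
      by (intro C_k_on_bilinear[OF bounded_bilinear_mult o] C_k_on_const Suc.IH)
  qed
qed

lemma C_infinity_on_inverse:
  fixes f :: "'a::euclidean_space \<Rightarrow> real"
  assumes "open U" "C_infinity_on U f" "\<And>x. x \<in> U \<Longrightarrow> f x \<noteq> 0"
  shows "C_infinity_on U (\<lambda>x. inverse (f x))"
  unfolding C_infinity_on_def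
proof
  fix k
  show "C_k_on k U (\<lambda>x. inverse (f x))"
    by (rule C_k_on_compose[where V = "- {0}"])
      (use assms C_k_on_inverse in \<open>auto simp: C_infinity_on_def\<close>)
qed

lemma C_k_on_sqrt: "C_k_on k {0<..} sqrt"
proof (induction k)
  case 0
  show ?case by (auto intro!: continuous_intros)
next
  case (Suc k)
  have o: "open {0 :: real<..}" by auto
  have *: "C_k_on k {0<..} (\<lambda>x. inverse (sqrt x))"
    by (rule C_k_on_compose[where V = "- {0}"]) (use Suc C_k_on_inverse in auto)
  show ?case
  proof (rule C_k_on_real_SucI[OF o])
    show "(sqrt has_real_derivative (1/2 * inverse (sqrt x))) (at x)" if "x \<in> {0<..}" for x :: real
      using that by (auto intro!: derivative_eq_intros simp: divide_simps)
    show "C_k_on k {0<..} (\<lambda>x :: real. 1/2 * inverse (sqrt x))"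
      by (intro C_k_on_bilinear[OF bounded_bilinear_mult o] C_k_on_const *)
  qed
qed

lemma C_infinity_on_sqrt:
  fixes f :: "'a::euclidean_space \<Rightarrow> real"
  assumes "open U" "C_infinity_on U f" "\<And>x. x \<in> U \<Longrightarrow> f x > 0"
  shows "C_infinity_on U (\<lambda>x. sqrt (f x))"
  unfolding C_infinity_on_def
proof
  fix k
  show "C_k_on k U (\<lambda>x. sqrt (f x))"
    by (rule C_k_on_compose[where V = "{0<..}"])
      (use assms C_k_on_sqrt in \<open>auto simp: C_infinity_on_def\<close>)
qed

lemma C_infinity_on_bilinear:
  assumes "bounded_bilinear B" "open U" "C_infinity_on U f" "C_infinity_on U g"
  shows "C_infinity_on U (\<lambda>x. B (f x) (g x))"
  using assms C_k_on_bilinear unfolding C_infinity_on_def by blast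

lemmas C_infinity_on_scaleR = C_infinity_on_bilinear[OF bounded_bilinear_scaleR]
lemmas C_infinity_on_mult = C_infinity_on_bilinear[OF bounded_bilinear_mult[where 'a=real]]
lemmas C_infinity_on_inner = C_infinity_on_bilinear[OF bounded_bilinear_inner]

lemma C_infinity_on_add:
  assumes "open U" "C_infinity_on U f" "C_infinity_on U g"
  shows "C_infinity_on U (\<lambda>x. f x + g x)"
  using assms C_k_on_add unfolding C_infinity_on_def by blast

lemma C_infinity_on_const: "C_infinity_on U (\<lambda>x. c)"
  by (simp add: C_infinity_on_def C_k_on_const)

lemma C_infinity_on_linear: "bounded_linear f \<Longrightarrow> C_infinity_on U f"
  by (simp add: C_infinity_on_def C_k_on_linear)

lemma C_infinity_on_diff:
  assumes "open U" "C_infinity_on U f" "C_infinity_on U g"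
  shows "C_infinity_on U (\<lambda>x. f x - g x)"
  using C_infinity_on_add[OF assms(1,2) C_infinity_on_scaleR[OF assms(1) C_infinity_on_const[of U "-1"] assms(3)]]
  by simp

lemma C_infinity_on_power:
  fixes f :: "'a::euclidean_space \<Rightarrow> real"
  assumes "open U" "C_infinity_on U f"
  shows "C_infinity_on U (\<lambda>x. f x ^ n)"
  by (induction n) (auto intro: C_infinity_on_const C_infinity_on_mult assms)

lemma C_infinity_on_compose:
  fixes f :: "'a::euclidean_space \<Rightarrow> 'b::euclidean_space" and g :: "'b \<Rightarrow> 'c::euclidean_space"
  assumes "open U" "open V" "C_infinity_on U f" "C_infinity_on V g" "f ` U \<subseteq> V"
  shows "C_infinity_on U (\<lambda>x. g (f x))"
  using assms C_k_on_compose unfolding C_infinity_on_def by blast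

lemma C_infinity_on_mono: "C_infinity_on U f \<Longrightarrow> V \<subseteq> U \<Longrightarrow> C_infinity_on V f"
  using C_k_on_mono unfolding C_infinity_on_def by blast

lemma C_infinity_on_imp_continuous_on: "C_infinity_on U f \<Longrightarrow> continuous_on U f"
  unfolding C_infinity_on_def using C_k_on.simps(1) by blast

text \<open>Openness is the open mapping theorem at points with invertible derivative. The inverse g
  satisfies g' = 1 / (f' o g), so if g is of class k then so is g', and g is of class k + 1.\<close>

lemma open_image_and_C_infinity_on_inverse_real:
  fixes f f' :: "real \<Rightarrow> real"
  assumes "open S" "\<And>x. x \<in> S \<Longrightarrow> (f has_real_derivative f' x) (at x)"
    "C_infinity_on S f'" "\<And>x. x \<in> S \<Longrightarrow> f' x \<noteq> 0" "inj_on f S"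
  shows "open (f ` S)" "C_infinity_on (f ` S) (inv_into S f)"
proof -
  let ?g = "inv_into S f"
  have cont: "continuous_on S f"
    using assms(2) by (meson DERIV_isCont continuous_at_imp_continuous_on)
  have id: "(*) (f' x) \<circ> (*) (inverse (f' x)) = id" if "x \<in> S" for x
    using assms(4)[OF that] by auto
  have "y \<in> interior (f ` S)" if y: "y \<in> f ` S" for y
  proof -
    obtain x where x: "x \<in> S" "y = f x" using y by blast
    show ?thesis
      unfolding x(2)
    proof (rule sussmann_open_mapping[OF assms(1) cont x(1) _ _ id[OF x(1)]])
      show "(f has_derivative (*) (f' x)) (at x)"
        using assms(2)[OF x(1)] by (simp add: has_field_derivative_def)
    qed (use x assms(1) in \<open>auto simp: bounded_linear_mult_right interior_open\<close>)
  qed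
  then show op: "open (f ` S)"
    by (metis interior_subset open_interior subsetI subset_antisym)
  have der: "(?g has_real_derivative (inverse (f' (?g y)))) (at y)" if y: "y \<in> f ` S" for y
  proof -
    obtain x where x: "x \<in> S" "y = f x" using y by blast
    have gx: "?g y = x" using x assms(5) by simp
    show ?thesis
      unfolding has_field_derivative_def gx
      unfolding x(2)
    proof (rule has_derivative_inverse_strong[OF assms(1) x(1) cont _ _ id[OF x(1)]])
      show "(f has_derivative (*) (f' x)) (at x)"
        using assms(2)[OF x(1)] by (simp add: has_field_derivative_def)
    qed (use assms(5) in auto)
  qed
  have gS: "?g ` f ` S \<subseteq> S"
    by (auto intro: inv_into_into)
  have "C_k_on k (f ` S) ?g" for k
  proof (induction k)
    case 0
    then show ?case
      by simp (meson DERIV_isCont continuous_at_imp_continuous_on der)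
  next
    case (Suc k)
    have "C_k_on k S f'"
      using assms(3) by (simp add: C_infinity_on_def)
    then have "C_k_on k (f ` S) (\<lambda>y. f' (?g y))"
      by (rule C_k_on_compose[OF op assms(1) Suc _ gS])
    then have "C_k_on k (f ` S) (\<lambda>y. inverse (f' (?g y)))"
      using gS assms(4) C_k_on_compose[OF op _ _ C_k_on_inverse, of k "\<lambda>y. f' (?g y)"]
      by fastforce
    then show ?case
      using C_k_on_real_SucI[OF op, of ?g "\<lambda>y. inverse (f' (?g y))"] der by simp
  qed
  then show "C_infinity_on (f ` S) ?g" by (simp add: C_infinity_on_def)
qed

section \<open>Smooth maps on arbitrary subsets, and diffeomorphisms\<close>

lemma smooth_onI_C_infinity: "open U \<Longrightarrow> X \<subseteq> U \<Longrightarrow> C_infinity_on U f \<Longrightarrow> smooth_on X f"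
  unfolding smooth_on_def by blast

lemma smooth_on_linear: "bounded_linear f \<Longrightarrow> smooth_on X f"
  by (rule smooth_onI_C_infinity[OF open_UNIV subset_UNIV C_infinity_on_linear])

lemma smooth_on_subset:
  assumes "smooth_on X f" "Y \<subseteq> X"
  shows "smooth_on Y f"
  unfolding smooth_on_def
proof (intro ballI)
  fix x assume "x \<in> Y"
  then obtain U g where "open U" "x \<in> U" "C_infinity_on U g" "\<forall>y\<in>X \<inter> U. g y = f y"
    using assms unfolding smooth_on_def by (meson subsetD)
  then show "\<exists>U g. open U \<and> x \<in> U \<and> C_infinity_on U g \<and> (\<forall>y\<in>Y \<inter> U. g y = f y)"
    using assms(2) by (intro exI[of _ U] exI[of _ g]) auto
qed

lemma smooth_on_imp_continuous_on:
  assumes "smooth_on X f"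
  shows "continuous_on X f"
  unfolding continuous_on_eq_continuous_within
proof
  fix x assume x: "x \<in> X"
  then obtain U g where U: "open U" "x \<in> U" "C_infinity_on U g" "\<forall>y\<in>X \<inter> U. g y = f y"
    using assms unfolding smooth_on_def by meson
  have "continuous (at x within X) g"
    using C_infinity_on_imp_continuous_on[OF U(3)] U(1,2)
    by (simp add: continuous_on_eq_continuous_at continuous_at_imp_continuous_at_within)
  moreover obtain e where e: "e > 0" "ball x e \<subseteq> U"
    using U(1,2) by (rule openE)
  moreover have "g y = f y" if "y \<in> X" "dist y x < e" for y
    using that e(2) U(4) by (auto simp: dist_commute)
  ultimately show "continuous (at x within X) f"
    using continuous_transform_within[of x X g e f] x by blast
qed

lemma smooth_on_compose:
  fixes f :: "'a::euclidean_space \<Rightarrow> 'b::euclidean_space" and g :: "'b \<Rightarrow> 'c::euclidean_space"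
  assumes "smooth_on X f" "smooth_on Y g" "f ` X \<subseteq> Y"
  shows "smooth_on X (\<lambda>x. g (f x))"
  unfolding smooth_on_def
proof (intro ballI)
  fix x assume x: "x \<in> X"
  obtain U f1 where U: "open U" "x \<in> U" "C_infinity_on U f1" "\<forall>y\<in>X \<inter> U. f1 y = f y"
    using assms(1) x unfolding smooth_on_def by meson
  have "f x \<in> Y" using x assms(3) by blast
  then obtain V g1 where V: "open V" "f x \<in> V" "C_infinity_on V g1" "\<forall>y\<in>Y \<inter> V. g1 y = g y"
    using assms(2) unfolding smooth_on_def by meson
  have o: "open (U \<inter> f1 -` V)"
    using C_infinity_on_imp_continuous_on[OF U(3)] U(1) V(1)
    by (simp add: continuous_on_open_vimage Int_commute)
  have "C_infinity_on (U \<inter> f1 -` V) (\<lambda>x. g1 (f1 x))"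
    by (rule C_infinity_on_compose[OF o V(1) _ V(3)]) (auto intro: C_infinity_on_mono[OF U(3)])
  moreover have "x \<in> U \<inter> f1 -` V"
    using x U V by auto
  moreover have "\<forall>y\<in>X \<inter> (U \<inter> f1 -` V). g1 (f1 y) = g (f y)"
    using U(4) V(4) assms(3) by auto
  ultimately show "\<exists>U h. open U \<and> x \<in> U \<and> C_infinity_on U h \<and> (\<forall>y\<in>X \<inter> U. h y = g (f y))"
    using o by (intro exI[of _ "U \<inter> f1 -` V"] exI[of _ "\<lambda>x. g1 (f1 x)"]) auto
qed

lemma diffeomorphicI:
  assumes "smooth_on X f" "smooth_on Y g" "f ` X \<subseteq> Y" "g ` Y \<subseteq> X"
    "\<And>x. x \<in> X \<Longrightarrow> g (f x) = x" "\<And>y. y \<in> Y \<Longrightarrow> f (g y) = y"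
  shows "diffeomorphic X Y"
proof -
  have "f ` X = Y" "g ` Y = X"
    using assms(3-6) by force+
  then show ?thesis
    unfolding diffeomorphic_def using assms by blast
qed

lemma diffeomorphic_sym: "diffeomorphic X Y \<Longrightarrow> diffeomorphic Y X"
  unfolding diffeomorphic_def by blast

lemma diffeomorphic_trans:
  assumes "diffeomorphic X Y" "diffeomorphic Y Z"
  shows "diffeomorphic X Z"
proof -
  obtain f g where fg: "smooth_on X f" "smooth_on Y g" "f ` X = Y" "g ` Y = X"
    "\<forall>x\<in>X. g (f x) = x" "\<forall>y\<in>Y. f (g y) = y"
    using assms(1) unfolding diffeomorphic_def by blast
  obtain h k where hk: "smooth_on Y h" "smooth_on Z k" "h ` Y = Z" "k ` Z = Y"
    "\<forall>x\<in>Y. k (h x) = x" "\<forall>y\<in>Z. h (k y) = y"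
    using assms(2) unfolding diffeomorphic_def by blast
  show ?thesis
  proof (rule diffeomorphicI)
    show "smooth_on X (\<lambda>x. h (f x))" using smooth_on_compose fg(1,3) hk(1) by blast
    show "smooth_on Z (\<lambda>x. g (k x))" using smooth_on_compose hk(2,4) fg(2) by blast
  qed (use fg hk in auto)
qed

lemma diffeomorphic_linear_image:
  assumes "bounded_linear f" "bounded_linear g" "\<And>x. g (f x) = x"
  shows "diffeomorphic X (f ` X)"
  by (rule diffeomorphicI[of X f _ g]) (use assms in \<open>auto simp: smooth_on_linear\<close>)

section \<open>Charts of the sphere\<close>

text \<open>The projection forgetting the first coordinate; its inverse is the graph of u -> sqrt (1
  - |u|^2), smooth because the radicand is positive inside the disc.\<close>

lemma diffeomorphic_hemisphere_disc:
  "diffeomorphic {y \<in> sphere (0 :: real ^ 3) 1. y $ 1 > 0} (ball (0 :: real ^ 2) 1)"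
proof (rule diffeomorphicI)
  let ?f = "\<lambda>y :: real ^ 3. y $ 2 *\<^sub>R axis 1 1 + y $ 3 *\<^sub>R axis 2 1 :: real ^ 2"
  let ?l = "\<lambda>u :: real ^ 2. u $ 1 *\<^sub>R axis 2 1 + u $ 2 *\<^sub>R axis 3 1 :: real ^ 3"
  let ?g = "\<lambda>u. sqrt (1 - u \<bullet> u) *\<^sub>R axis 1 1 + ?l u"
  have norm2: "norm u < 1 \<longleftrightarrow> (u $ 1)\<^sup>2 + (u $ 2)\<^sup>2 < 1" for u :: "real ^ 2"
    by (simp add: norm_eq_sqrt_inner inner_vec_def sum_2 power2_eq_square)
  have norm3: "norm y = 1 \<longleftrightarrow> (y $ 1)\<^sup>2 + (y $ 2)\<^sup>2 + (y $ 3)\<^sup>2 = 1" for y :: "real ^ 3"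
    by (simp add: norm_eq_sqrt_inner inner_vec_def sum_3 power2_eq_square)
  have inner2: "u \<bullet> u = (u $ 1)\<^sup>2 + (u $ 2)\<^sup>2" for u :: "real ^ 2"
    by (simp add: inner_vec_def sum_2 power2_eq_square)
  have f: "?f y $ 1 = y $ 2" "?f y $ 2 = y $ 3" for y
    by (simp_all add: axis_def)
  have g: "?g u $ 1 = sqrt (1 - u \<bullet> u)" "?g u $ 2 = u $ 1" "?g u $ 3 = u $ 2" for u
    by (simp_all add: axis_def)
  have "bounded_linear ?f"
    by (intro linear_conv_bounded_linear[THEN iffD1] linearI) (simp_all add: algebra_simps)
  then show "smooth_on {y \<in> sphere 0 1. y $ 1 > 0} ?f"
    by (rule smooth_on_linear)
  have l: "bounded_linear ?l"
    by (intro linear_conv_bounded_linear[THEN iffD1] linearI) (simp_all add: algebra_simps)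
  show "smooth_on (ball 0 1) ?g"
  proof (rule smooth_onI_C_infinity[OF open_ball order_refl])
    have "1 - u \<bullet> u > 0" if "u \<in> ball 0 1" for u :: "real ^ 2"
      using that norm2[of u] by (simp add: inner2)
    then show "C_infinity_on (ball 0 1) ?g"
      by (intro C_infinity_on_add C_infinity_on_scaleR C_infinity_on_sqrt C_infinity_on_diff
          C_infinity_on_inner C_infinity_on_const C_infinity_on_linear l open_ball bounded_linear_ident)
  qed
  show "?f ` {y \<in> sphere 0 1. y $ 1 > 0} \<subseteq> ball 0 1"
  proof safe
    fix y :: "real ^ 3" assume "y \<in> sphere 0 1" "y $ 1 > 0"
    then have "(y $ 1)\<^sup>2 + (y $ 2)\<^sup>2 + (y $ 3)\<^sup>2 = 1" "(y $ 1)\<^sup>2 > 0"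
      using norm3[of y] by auto
    then show "?f y \<in> ball 0 1"
      unfolding mem_ball_0 norm2 f by linarith
  qed
  show "?g ` ball 0 1 \<subseteq> {y \<in> sphere 0 1. y $ 1 > 0}"
  proof safe
    fix u :: "real ^ 2" assume "u \<in> ball 0 1"
    then have "u \<bullet> u < 1"
      by (simp add: norm2 inner2)
    then show "?g u \<in> sphere 0 1" "?g u $ 1 > 0"
      unfolding mem_sphere_0 norm3 g by (simp_all add: inner2)
  qed
  show "?g (?f y) = y" if "y \<in> {y \<in> sphere 0 1. y $ 1 > 0}" for y
  proof -
    have "1 - ((y $ 2)\<^sup>2 + (y $ 3)\<^sup>2) = (y $ 1)\<^sup>2" "y $ 1 > 0"
      using that norm3[of y] by auto
    then have "sqrt (1 - ?f y \<bullet> ?f y) = y $ 1"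
      unfolding inner2 f by simp
    then show ?thesis
      unfolding vec_eq_iff forall_3 g f by (simp add: axis_def)
  qed
  show "?f (?g u) = u" for u
    unfolding vec_eq_iff forall_2 f g by (simp add: axis_def)
qed

text \<open>An orthogonal map taking \<open>p\<close> to the first basis vector pulls the hemisphere
  chart back to a neighbourhood of \<open>p\<close>.\<close>

lemma sphere_chart:
  fixes p :: "real ^ 3"
  assumes "p \<in> sphere 0 1"
  obtains W and U :: "(real ^ 2) set"
  where "openin (top_of_set (sphere 0 1)) W" "p \<in> W" "open U" "diffeomorphic W U"
proof -
  obtain r :: "real ^ 3 \<Rightarrow> real ^ 3" where r: "orthogonal_transformation r" "r p = axis 1 1"
    using assms orthogonal_transformation_exists_1[of p "axis 1 1"] by auto
  have lin: "bounded_linear r" "bounded_linear (inv r)"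
    using r(1) orthogonal_transformation_inv[OF r(1)]
    by (simp_all add: orthogonal_transformation_linear linear_conv_bounded_linear[symmetric])
  have inv: "inv r (r x) = x" "r (inv r x) = x" for x
    using orthogonal_transformation_bij[OF r(1)] by (simp_all add: bij_def surj_f_inv_f)
  let ?W = "{y \<in> sphere 0 1. r y $ 1 > 0}"
  have "r ` ?W = {y \<in> sphere 0 1. y $ 1 > 0}"
  proof (intro equalityI subsetI)
    fix z :: "real ^ 3" assume z: "z \<in> {y \<in> sphere 0 1. y $ 1 > 0}"
    then have "inv r z \<in> ?W"
      using orthogonal_transformation_norm[OF r(1), of "inv r z"] by (simp add: inv)
    then show "z \<in> r ` ?W"
      using image_eqI[of z r "inv r z"] by (simp add: inv)
  qed (auto simp: orthogonal_transformation_norm[OF r(1)])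
  then have "diffeomorphic ?W {y \<in> sphere (0 :: real ^ 3) 1. y $ 1 > 0}"
    using diffeomorphic_linear_image[OF lin inv(1), of ?W] by simp
  then have "diffeomorphic ?W (ball (0 :: real ^ 2) 1)"
    by (rule diffeomorphic_trans[OF _ diffeomorphic_hemisphere_disc])
  moreover have "openin (top_of_set (sphere 0 1)) ?W"
  proof -
    have "open {y. r y $ 1 > 0}"
      by (intro open_Collect_less continuous_intros linear_continuous_on[OF lin(1)])
    then show ?thesis
      by (auto simp: openin_open intro!: exI[of _ "{y. r y $ 1 > 0}"])
  qed
  moreover have "p \<in> ?W"
    using assms r(2) by (simp add: axis_def)
  ultimately show ?thesis
    using that[of ?W "ball 0 1"] by simp
qed

lemma smooth_submanifold_if_locally_sphere:
  fixes M :: "'a::euclidean_space set"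
  assumes "\<And>p. p \<in> M \<Longrightarrow> \<exists>S. openin (top_of_set M) S \<and> p \<in> S \<and> diffeomorphic S (sphere (0 :: real ^ 3) 1)"
  shows "smooth_submanifold TYPE(real ^ 2) M"
  unfolding smooth_submanifold_def
proof
  fix p assume "p \<in> M"
  then obtain S where S: "openin (top_of_set M) S" "p \<in> S" "diffeomorphic S (sphere (0 :: real ^ 3) 1)"
    using assms by blast
  obtain f g where fg: "smooth_on S f" "smooth_on (sphere (0 :: real ^ 3) 1) g" "f ` S = sphere 0 1"
    "\<forall>x\<in>S. g (f x) = x" "\<forall>y\<in>sphere 0 1. f (g y) = y" "g ` sphere 0 1 = S"
    using S(3) unfolding diffeomorphic_def by blast
  have "f p \<in> sphere 0 1"
    using fg(3) S(2) by blast
  then obtain W and U :: "(real ^ 2) set"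
    where W: "openin (top_of_set (sphere 0 1)) W" "f p \<in> W" "open U" "diffeomorphic W U"
    using sphere_chart by metis
  have W_sub: "W \<subseteq> sphere 0 1"
    using W(1) openin_imp_subset by blast
  let ?V = "S \<inter> f -` W"
  have "openin (top_of_set S) ?V"
    using continuous_openin_preimage[OF smooth_on_imp_continuous_on[OF fg(1)] _ W(1)] fg(3) by blast
  then have "openin (top_of_set M) ?V"
    using S(1) openin_trans by blast
  moreover have "diffeomorphic ?V W"
  proof (rule diffeomorphicI[of _ f _ g])
    show "smooth_on ?V f" "smooth_on W g"
      using smooth_on_subset fg(1,2) W_sub by blast+
  qed (use fg W_sub in auto)
  ultimately show "\<exists>V (U :: (real ^ 2) set). openin (top_of_set M) V \<and> p \<in> V \<and> open U \<and> diffeomorphic V U"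
    using S(2) W diffeomorphic_trans by blast
qed

section \<open>The cubic power sum along a great circle\<close>

definition radius :: "real \<Rightarrow> real" where
  "radius w = sqrt (1 + 5/4 * w\<^sup>2)"

definition ray_cubic :: "real \<Rightarrow> real \<Rightarrow> real" where
  "ray_cubic w q = (15/16 * w ^ 3 - 3/4 * w + q) / radius w ^ 3"

text \<open>The points of a half great circle are \<open>(w e + y) / radius w\<close> with \<open>e = (1, -1/4, ..., -1/4)\<close>
  and \<open>y\<close> a unit vector orthogonal to \<open>e\<close> in the hyperplane; \<open>q\<close> is the cubic power sum of \<open>y\<close>.
  At \<open>w_crit\<close> the first coordinate \<open>w / radius w\<close> equals \<open>3 / sqrt 30\<close>.\<close>

definition w_crit :: real where
  "w_crit = 6/5 * (1 / sqrt 3)"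

lemma radius_pos: "radius w > 0"
  by (simp add: radius_def add_pos_nonneg)

lemma radius_power2: "(radius w)\<^sup>2 = 1 + 5/4 * w\<^sup>2"
  by (simp add: radius_def)

lemma radius_has_derivative:
  "(radius has_real_derivative (5/4 * w / radius w)) (at w)"
proof -
  have "1 + 5/4 * w\<^sup>2 > 0" by (simp add: add_pos_nonneg)
  moreover have "((\<lambda>w :: real. 1 + 5/4 * w\<^sup>2) has_real_derivative 5/2 * w) (at w)"
    by (auto intro!: derivative_eq_intros)
  ultimately have "((\<lambda>w. sqrt (1 + 5/4 * w\<^sup>2)) has_real_derivative
      (inverse (sqrt (1 + 5/4 * w\<^sup>2)) / 2) * (5/2 * w)) (at w)"
    by (intro DERIV_chain2[OF DERIV_real_sqrt])
  then show ?thesis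
    unfolding radius_def [abs_def] by (simp add: field_simps)
qed

text \<open>The terms in w^4 cancel after the quotient rule, so the sign of the slope is that of a
  quadratic in \<open>w\<close>.\<close>

lemma ray_cubic_has_derivative:
  "((\<lambda>w. ray_cubic w q) has_real_derivative
     ((75/16 * w\<^sup>2 - 3/4 - 15/4 * w * q) / radius w ^ 5)) (at w)"
proof -
  let ?p = "15/16 * w ^ 3 - 3/4 * w + q"
  have "((\<lambda>w. ray_cubic w q) has_real_derivative
     (((45/16 * w\<^sup>2 - 3/4) * radius w ^ 3 - ?p * (3 * (radius w)\<^sup>2 * (5/4 * w / radius w))) /
       (radius w ^ 3 * radius w ^ 3))) (at w)"
    unfolding ray_cubic_def using radius_pos[of w]
    by (auto intro!: derivative_eq_intros radius_has_derivative simp: power2_eq_square)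
  moreover have "((45/16 * w\<^sup>2 - 3/4) * radius w ^ 3 - ?p * (3 * (radius w)\<^sup>2 * (5/4 * w / radius w))) /
       (radius w ^ 3 * radius w ^ 3) = ((45/16 * w\<^sup>2 - 3/4) * (radius w)\<^sup>2 - 15/4 * w * ?p) / radius w ^ 5"
    using radius_pos[of w] by (simp add: field_simps power2_eq_square eval_nat_numeral)
  moreover have "(45/16 * w\<^sup>2 - 3/4) * (radius w)\<^sup>2 - 15/4 * w * ?p = 75/16 * w\<^sup>2 - 3/4 - 15/4 * w * q"
    unfolding radius_power2 by (simp add: field_simps eval_nat_numeral)
  ultimately show ?thesis by simp
qed

lemma isCont_ray_cubic: "isCont (\<lambda>w. ray_cubic w q) w"
  using ray_cubic_has_derivative DERIV_isCont by blast

lemma w_crit_pos: "w_crit > 0"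
  by (simp add: w_crit_def)

text \<open>For \<open>w > 0\<close> the worst case is \<open>q = 1 / sqrt 3\<close>. The quadratic
  then factors, and \<open>w_crit\<close> is its larger root.\<close>

lemma ray_cubic_slope_pos:
  assumes "w > w_crit" "q \<le> 1 / sqrt 3"
  shows "75/16 * w\<^sup>2 - 3/4 - 15/4 * w * q > 0"
proof -
  let ?k = "1 / sqrt 3"
  have k: "?k * ?k = 1/3" "?k > 0" by simp_all
  have "w > 0" using assms(1) w_crit_pos by linarith
  then have "w * q \<le> w * ?k"
    by (intro mult_left_mono assms(2)) simp
  moreover have "75/16 * (w - 6/5 * k) * (w + 2/5 * k) = 75/16 * w\<^sup>2 - 9/4 * (k * k) - 15/4 * (w * k)" for k
    by (simp add: field_simps power2_eq_square)
  note this[of ?k]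
  moreover have "75/16 * (w - 6/5 * ?k) * (w + 2/5 * ?k) > 0"
  proof (intro mult_pos_pos)
    show "w - 6/5 * ?k > 0" using assms(1) unfolding w_crit_def by linarith
    show "w + 2/5 * ?k > 0" using \<open>w > 0\<close> k(2) by linarith
  qed simp
  ultimately show ?thesis
    unfolding k(1) by linarith
qed

lemma ray_cubic_strict_mono:
  assumes "w_crit \<le> u" "u < v" "q \<le> 1 / sqrt 3"
  shows "ray_cubic u q < ray_cubic v q"
\<comment> \<open>A positive slope on the open interval suffices, which includes
  \<open>u = w_crit\<close>, where the slope vanishes for \<open>q = 1 / sqrt 3\<close>.\<close>
proof (rule DERIV_pos_imp_increasing_open[OF assms(2)])
  fix w assume "u < w" "w < v"
  then have "75/16 * w\<^sup>2 - 3/4 - 15/4 * w * q > 0"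
    using assms ray_cubic_slope_pos by simp
  then show "\<exists>y. ((\<lambda>w. ray_cubic w q) has_real_derivative y) (at w) \<and> y > 0"
    using ray_cubic_has_derivative[of q w] radius_pos[of w] by (meson divide_pos_pos zero_less_power)
qed (simp add: continuous_at_imp_continuous_on isCont_ray_cubic)

text \<open>The value increases with \<open>q\<close>, and at \<open>q = 1 / sqrt 3\<close> it is
  exactly \<open>1 / sqrt 30\<close>: the lower end of the range of \<open>C\<close>.\<close>

lemma ray_cubic_w_crit_le:
  assumes "q \<le> 1 / sqrt 3"
  shows "ray_cubic w_crit q \<le> 1 / sqrt 30"
proof -
  let ?k = "1 / sqrt 3"
  have k: "?k ^ 2 = 1/3" by (simp add: power_divide)
  have r: "(radius w_crit)\<^sup>2 = 8/5"
    unfolding radius_power2 w_crit_def power_mult_distrib k by (simp add: power2_eq_square)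
  have "15/16 * w_crit ^ 3 - 3/4 * w_crit + q \<le> 15/16 * w_crit ^ 3 - 3/4 * w_crit + ?k"
    using assms by simp
  also have "\<dots> = 81/50 * (?k\<^sup>2 * ?k) + 1/10 * ?k"
    unfolding w_crit_def by (simp add: field_simps eval_nat_numeral)
  also have "\<dots> = 16/25 * ?k"
    unfolding k by simp
  finally have "ray_cubic w_crit q \<le> (16/25 * ?k) / radius w_crit ^ 3"
    unfolding ray_cubic_def using radius_pos[of w_crit] by (intro divide_right_mono) simp_all
  also have "\<dots> = (2/5 * ?k) / radius w_crit"
  proof -
    have "radius w_crit ^ 3 = 8/5 * radius w_crit"
      unfolding r[symmetric] by (simp add: power2_eq_square eval_nat_numeral)
    then show ?thesis by (simp only: \<open>radius w_crit ^ 3 = _\<close>) simp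
  qed
  also have "\<dots> = 1 / sqrt 30"
  proof -
    have "((2/5 * ?k) / radius w_crit)\<^sup>2 = 1/30"
      unfolding power_divide power_mult_distrib r by (simp add: power_divide power2_eq_square)
    then have "(2/5 * ?k) / radius w_crit = sqrt (1/30)"
      using radius_pos[of w_crit] by (intro real_sqrt_unique[symmetric]) auto
    then show ?thesis by (simp add: real_sqrt_divide)
  qed
  finally show ?thesis .
qed

text \<open>Every half great circle runs into the pole as \<open>w\<close> grows; the limit is the
  cubic power sum of the unit vector along (4,-1,-1,-1,-1), namely 60 / (20 sqrt 20).\<close>

lemma ray_cubic_at_top: "((\<lambda>w. ray_cubic w q) \<longlongrightarrow> 3 / sqrt 20) at_top"
proof -
  have "((\<lambda>w. ray_cubic w q) \<longlongrightarrow> 15 * inverse (((5/4) powr (1/2)) ^ 3) / 16) at_top"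
    unfolding ray_cubic_def radius_def by real_asymp
  then have "((\<lambda>w. ray_cubic w q) \<longlongrightarrow> 15/16 / sqrt (5/4) ^ 3) at_top"
    by (simp add: powr_half_sqrt field_simps)
  moreover have "15/16 / sqrt (5/4) ^ 3 = 3 / sqrt 20"
  proof -
    have "sqrt 20 = sqrt (5/4 * 4\<^sup>2)" by simp
    also have "\<dots> = 4 * sqrt (5/4)" by (simp only: real_sqrt_mult real_sqrt_abs abs_numeral mult.commute)
    finally have "sqrt 20 = 4 * sqrt (5/4)" .
    moreover have "sqrt (5/4) ^ 3 = 5/4 * sqrt (5/4)" by (simp add: eval_nat_numeral)
    ultimately show ?thesis by (simp only:) simp
  qed
  ultimately show ?thesis by simp
qed

text \<open>Existence is the intermediate value theorem between \<open>w_crit\<close>, where the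
  value is at most \<open>1 / sqrt 30\<close>, and a far point, where it exceeds \<open>C\<close>.
  Uniqueness is strict monotonicity.\<close>

lemma ex1_ray_cubic_eq:
  assumes "1 / sqrt 30 \<le> C" "C < 3 / sqrt 20" "q \<le> 1 / sqrt 3"
  shows "\<exists>!w. w \<ge> w_crit \<and> ray_cubic w q = C"
proof -
  have "eventually (\<lambda>w. ray_cubic w q > C \<and> w \<ge> w_crit) at_top"
    using order_tendstoD(1)[OF ray_cubic_at_top assms(2)] eventually_ge_at_top
    by (rule eventually_conj)
  then obtain b where b: "ray_cubic b q > C" "b \<ge> w_crit"
    unfolding eventually_at_top_linorder by blast
  then obtain w where "w \<ge> w_crit" "ray_cubic w q = C"
    using IVT[of "\<lambda>w. ray_cubic w q" w_crit C b] ray_cubic_w_crit_le[OF assms(3)] assms(1) isCont_ray_cubic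
    by force
  moreover have "u = v" if "u \<ge> w_crit" "ray_cubic u q = C" "v \<ge> w_crit" "ray_cubic v q = C" for u v
    using ray_cubic_strict_mono[of u v q] ray_cubic_strict_mono[of v u q] that assms(3) by force
  ultimately show ?thesis by blast
qed

section \<open>The five lobes and the singular points\<close>

lemma UNIV_5: "(UNIV :: 5 set) = {0, 1, 2, 3, 4}"
proof -
  have "z \<in> {0, 1, 2, 3, 4}" for z :: 5
  proof (induct z)
    case (of_int z)
    then have "z = 0 \<or> z = 1 \<or> z = 2 \<or> z = 3 \<or> z = 4" by simp arith
    then show ?case by auto
  qed
  then show ?thesis by blast
qed

lemma sum_5: "sum f (UNIV :: 5 set) = f 0 + f 1 + f 2 + f 3 + f 4"
  unfolding UNIV_5 by (simp add: ac_simps)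

lemma forall_5: "(\<forall>i :: 5. P i) \<longleftrightarrow> P 0 \<and> P 1 \<and> P 2 \<and> P 3 \<and> P 4"
proof -
  have "(\<forall>i :: 5. P i) \<longleftrightarrow> (\<forall>i\<in>UNIV. P i)" by simp
  then show ?thesis unfolding UNIV_5 by simp
qed

lemma mem_A3: "x \<in> A3 C \<longleftrightarrow>
    (\<Sum>i\<in>UNIV. x $ i) = 0 \<and> (\<Sum>i\<in>UNIV. (x $ i)\<^sup>2) = 1 \<and> (\<Sum>i\<in>UNIV. (x $ i) ^ 3) = C"
  by (simp add: A3_def power_sum_def)

lemma A3_uminus: "A3 (- C) = uminus ` A3 C"
proof -
  have "x \<in> A3 (- C) \<longleftrightarrow> - x \<in> A3 C" for x
    by (auto simp: mem_A3 sum_negf)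
  moreover have "x \<in> uminus ` A3 C \<longleftrightarrow> - x \<in> A3 C" for x
    using image_eqI[of x uminus "- x" "A3 C"] by auto
  ultimately show ?thesis by blast
qed

definition lobe :: "real \<Rightarrow> 5 \<Rightarrow> (real ^ 5) set" where
  "lobe C i = {x \<in> A3 C. x $ i \<ge> 3 / sqrt 30}"

text \<open>The values are in ratio 3 : -2 because two entries of one and three of the other must
  sum to zero. With \<open>card J = 2\<close> and \<open>c\<^sup>2 = 1/30\<close> these turn out to
  be the singular points.\<close>

definition two_valued :: "real \<Rightarrow> 5 set \<Rightarrow> real ^ 5" where
  "two_valued c J = (\<chi> i. if i \<in> J then 3 * c else - 2 * c)"

lemma sum_two_valued:
  "(\<Sum>i\<in>UNIV. g (two_valued c J $ i)) = of_nat (card J) * g (3 * c) + (5 - of_nat (card J)) * (g (- 2 * c) :: real)"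
proof -
  have "(\<Sum>i\<in>UNIV. g (two_valued c J $ i)) = (\<Sum>i\<in>J. g (3 * c)) + (\<Sum>i\<in>- J. g (- 2 * c))"
    unfolding two_valued_def using sum.If_cases[of UNIV "\<lambda>i. i \<in> J" "\<lambda>_. g (3 * c)" "\<lambda>_. g (- 2 * c)"]
    by (simp add: if_distrib)
  moreover have "card (- J) + card J = 5"
    using card_Un_disjoint[of "- J" J] by (simp add: Compl_partition2)
  then have "real (card (- J)) = 5 - real (card J)" by linarith
  ultimately show ?thesis by simp
qed

text \<open>Both 2 * 3^2 + 3 * 2^2 and 2 * 3^3 - 3 * 2^3 equal 30.\<close>

lemma two_valued_in_A3:
  assumes "card J = 2" "c\<^sup>2 = 1/30"
  shows "two_valued c J \<in> A3 c"
proof -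
  have c3: "c ^ 3 = c / 30"
    using assms(2) by (metis mult.commute power2_eq_square power3_eq_cube times_divide_eq_right mult.right_neutral)
  have "(\<Sum>i\<in>UNIV. two_valued c J $ i) = 0"
    unfolding sum_two_valued[of "\<lambda>x. x"] assms(1) by simp
  moreover have "(\<Sum>i\<in>UNIV. (two_valued c J $ i)\<^sup>2) = 1"
    unfolding sum_two_valued[of "\<lambda>x. x\<^sup>2"] assms(1) by (simp add: power_mult_distrib assms(2))
  moreover have "(\<Sum>i\<in>UNIV. (two_valued c J $ i) ^ 3) = c"
    unfolding sum_two_valued[of "\<lambda>x. x ^ 3"] assms(1) by (simp add: power_mult_distrib c3)
  ultimately show ?thesis
    by (simp add: mem_A3)
qed

lemma inj_two_valued:
  assumes "c \<noteq> 0"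
  shows "inj (two_valued c)"
proof (rule injI)
  have *: "i \<in> J \<longleftrightarrow> two_valued c J $ i = 3 * c" for i J
    using assms by (simp add: two_valued_def)
  fix J K assume "two_valued c J = two_valued c K"
  then show "J = K"
    by (simp add: set_eq_iff *)
qed

section \<open>Singular points through Lagrange multipliers\<close>

lemma power_sum_has_derivative:
  "(power_sum k has_derivative (\<lambda>h. \<Sum>i\<in>UNIV. of_nat k * (p $ i) ^ (k - 1) * h $ i)) (at p)"
proof -
  have "((\<lambda>x. (x $ i) ^ k) has_derivative (\<lambda>h. of_nat k * (p $ i) ^ (k - 1) * h $ i)) (at p)" for i
    using has_derivative_power[OF bounded_linear_imp_has_derivative[OF bounded_linear_vec_nth], where n = k]
    by (simp add: mult_ac)
  then show ?thesis
    unfolding power_sum_def [abs_def] by (intro has_derivative_sum) simp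
qed

lemma singular_points_eq:
  assumes "C\<^sup>2 = 1/30"
  shows "singular_points C = two_valued C ` {J. card J = 2}"
proof -
  have fd: "frechet_derivative (power_sum k) (at p) h = (\<Sum>i\<in>UNIV. of_nat k * (p $ i) ^ (k - 1) * h $ i)" for k p h
    by (simp add: frechet_derivative_at[OF power_sum_has_derivative, symmetric])
  have comb: "a * frechet_derivative (power_sum 1) (at p) h + b * frechet_derivative (power_sum 2) (at p) h
      + c * frechet_derivative (power_sum 3) (at p) h
    = (\<Sum>i\<in>UNIV. (a + 2 * b * p $ i + 3 * c * (p $ i)\<^sup>2) * h $ i)" for a b c p h
    unfolding fd sum_distrib_left sum.distrib[symmetric]
    by (intro sum.cong) (simp_all add: algebra_simps)
  have "C \<noteq> 0" using assms by auto
  show ?thesis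
  proof (intro equalityI subsetI)
    fix p assume "p \<in> singular_points C"
    then obtain a b c where p: "p \<in> A3 C" and abc: "(a, b, c) \<noteq> (0, 0, 0)"
      and dep: "\<And>h. (\<Sum>i\<in>UNIV. (a + 2 * b * p $ i + 3 * c * (p $ i)\<^sup>2) * h $ i) = 0"
      unfolding singular_points_def comb by blast
    \<comment> \<open>Testing the dependence on the coordinate vectors makes every coordinate a root
      of one fixed polynomial of degree at most two.\<close>
    have root: "a + 2 * b * p $ i + 3 * c * (p $ i)\<^sup>2 = 0" for i
      using dep[of "axis i 1"] by (simp add: axis_def if_distrib cong: if_cong)
    \<comment> \<open>Summing the root relation, first plainly and then weighted by the coordinates,
      brings in the power sums 0, 1 and \<open>C\<close> and fixes the ratios of \<open>a\<close>,
      \<open>b\<close>, \<open>c\<close>.\<close>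
    have "(\<Sum>i\<in>UNIV. a + 2 * b * p $ i + 3 * c * (p $ i)\<^sup>2)
        = 5 * a + 2 * b * (\<Sum>i\<in>UNIV. p $ i) + 3 * c * (\<Sum>i\<in>UNIV. (p $ i)\<^sup>2)"
      by (simp add: sum.distrib sum_distrib_left)
    then have a: "5 * a + 3 * c = 0"
      using p unfolding root mem_A3 by simp
    have "(\<Sum>i\<in>UNIV. (a + 2 * b * p $ i + 3 * c * (p $ i)\<^sup>2) * p $ i)
        = a * (\<Sum>i\<in>UNIV. p $ i) + 2 * b * (\<Sum>i\<in>UNIV. (p $ i)\<^sup>2) + 3 * c * (\<Sum>i\<in>UNIV. (p $ i) ^ 3)"
      by (simp add: sum.distrib sum_distrib_left algebra_simps eval_nat_numeral)
    then have b: "2 * b + 3 * c * C = 0"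
      using p unfolding root mem_A3 by simp
    have "c \<noteq> 0" using abc a b by auto
    have val: "p $ i = 3 * C \<or> p $ i = - 2 * C" for i
    proof -
      \<comment> \<open>With a = -3c/5 and b = -3cC/2 the polynomial is 3c (t^2 - C t - 1/5), and
        1/5 = 6 C^2 makes it factor.\<close>
      have "3 * c * ((p $ i - 3 * C) * (p $ i + 2 * C)) = 3 * c * (p $ i)\<^sup>2 - 3 * c * C * p $ i - 18 * c * C\<^sup>2"
        by (simp add: algebra_simps power2_eq_square)
      also have "\<dots> = a + 2 * b * p $ i + 3 * c * (p $ i)\<^sup>2"
        using a b unfolding assms by (simp add: eq_neg_iff_add_eq_0[symmetric])
      finally show ?thesis using root[of i] \<open>c \<noteq> 0\<close> by auto
    qed
    define J where "J = {i. p $ i = 3 * C}"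
    have pJ: "p = two_valued C J"
      using val by (auto simp: vec_eq_iff two_valued_def J_def)
    \<comment> \<open>The vanishing coordinate sum determines how often each root occurs.\<close>
    have "real (card J) * (3 * C) + (5 - real (card J)) * (- 2 * C) = 0"
      using p sum_two_valued[of "\<lambda>x. x" C J] unfolding mem_A3 pJ by simp
    then have "5 * C * (real (card J) - 2) = 0" by (simp add: algebra_simps)
    then have "card J = 2" using \<open>C \<noteq> 0\<close> by simp
    then show "p \<in> two_valued C ` {J. card J = 2}" using pJ by blast
  next
    fix p assume "p \<in> two_valued C ` {J. card J = 2}"
    then obtain J where J: "card J = 2" "p = two_valued C J" by blast
    \<comment> \<open>The multipliers are the coefficients of t^2 - C t - 6 C^2 divided by the
      factors 1, 2, 3 that differentiation produces.\<close>
    have "- 6 * C\<^sup>2 + 2 * (- C / 2) * p $ i + 3 * (1/3) * (p $ i)\<^sup>2 = 0" for i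
      unfolding J(2) two_valued_def by (simp add: power2_eq_square)
    then have "\<forall>h. (- 6 * C\<^sup>2) * frechet_derivative (power_sum 1) (at p) h
        + (- C / 2) * frechet_derivative (power_sum 2) (at p) h
        + (1/3) * frechet_derivative (power_sum 3) (at p) h = 0"
      unfolding comb by simp
    moreover have "(- 6 * C\<^sup>2, - C / 2, 1/3) \<noteq> (0, 0, 0 :: real)" by simp
    ultimately show "p \<in> singular_points C"
      using two_valued_in_A3[OF J(1) assms] J(2) unfolding singular_points_def by blast
  qed
qed

lemma card_singular_points:
  assumes "C\<^sup>2 = 1/30"
  shows "card (singular_points C) = 5 choose 2"
proof -
  have "C \<noteq> 0" using assms by auto
  then have "card (singular_points C) = card {J :: 5 set. card J = 2}"
    unfolding singular_points_eq[OF assms]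
    by (intro card_image inj_on_subset[OF inj_two_valued]) auto
  also have "\<dots> = 5 choose 2"
    using n_subsets[of "UNIV :: 5 set" 2] by simp
  finally show ?thesis .
qed

section \<open>Covering by the five lobes and their overlaps\<close>

lemma exists_large_coordinate:
  assumes "x \<in> A3 C" "c > 0" "c\<^sup>2 = 1/30" "c \<le> C"
  shows "\<exists>i. x $ i \<ge> 3 * c" "c < C \<Longrightarrow> \<exists>i. x $ i > 3 * c"
proof -
  let ?P = "\<lambda>i. (x $ i - 3 * c) * (x $ i + 2 * c)\<^sup>2"
  \<comment> \<open>Expand (t - 3c) (t + 2c)^2 = t^3 + c t^2 - 8 c^2 t - 12 c^3. The sum is C + c -
    60 c^3, and 60 c^3 = 2c; the double root leaves the sign of each term to t - 3c.\<close>
  have "(\<Sum>i\<in>UNIV. ?P i) = (\<Sum>i\<in>UNIV. (x $ i) ^ 3) + c * (\<Sum>i\<in>UNIV. (x $ i)\<^sup>2)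
      - 8 * c\<^sup>2 * (\<Sum>i\<in>UNIV. x $ i) - 5 * (12 * c\<^sup>2 * c)"
    unfolding sum_5 by (simp add: algebra_simps eval_nat_numeral)
  then have S: "(\<Sum>i\<in>UNIV. ?P i) = C - c"
    using assms(1) unfolding assms(3) mem_A3 by simp
  show "\<exists>i. x $ i > 3 * c" if "c < C"
  proof (rule ccontr)
    assume "\<not> (\<exists>i. x $ i > 3 * c)"
    then have "?P i \<le> 0" for i by (intro mult_nonpos_nonneg) (auto simp: not_less)
    then have "(\<Sum>i\<in>UNIV. ?P i) \<le> 0" by (intro sum_nonpos) auto
    then show False using S that by simp
  qed
  show "\<exists>i. x $ i \<ge> 3 * c"
  proof (rule ccontr)
    assume "\<not> (\<exists>i. x $ i \<ge> 3 * c)"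
    then have neg: "x $ i - 3 * c < 0" for i by (auto simp: not_le)
    then have "?P i \<le> 0" for i by (intro mult_nonpos_nonneg) (auto intro: less_imp_le)
    moreover have "(\<Sum>i\<in>UNIV. ?P i) \<ge> 0" using S assms(4) by simp
    \<comment> \<open>Nonpositive terms with a nonnegative sum all vanish, which forces every
      coordinate to be -2c, against the coordinate sum zero.\<close>
    ultimately have "(\<Sum>i\<in>UNIV. - ?P i) = 0" "\<And>i. - ?P i \<ge> 0"
      using sum_nonpos[of UNIV ?P] by (auto simp: sum_negf)
    then have P0: "- ?P i = 0" for i
      using sum_nonneg_eq_0_iff[of UNIV "\<lambda>i. - ?P i"] by simp
    have "x $ i = - 2 * c" for i
      using P0[of i] neg[of i] by (auto simp: eq_neg_iff_add_eq_0)
    then have "(\<Sum>i\<in>UNIV. x $ i) = - 10 * c" by simp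
    then show False using assms(1,2) unfolding mem_A3 by simp
  qed
qed

text \<open>Both points are unit vectors, so only their inner product matters; the constant part -2c
  of the second one is orthogonal to \<open>x\<close>, leaving the two spikes of height 5c.\<close>

lemma dist_two_valued:
  assumes "x \<in> A3 C" "c\<^sup>2 = 1/30" "i \<noteq> j"
  shows "(dist x (two_valued c {i, j}))\<^sup>2 = 2 - 10 * c * (x $ i + x $ j)"
proof -
  let ?p = "two_valued c {i, j}"
  have p: "?p $ k = - 2 * c + 5 * c * (if k = i then 1 else 0) + 5 * c * (if k = j then 1 else 0)" for k
    using assms(3) by (auto simp: two_valued_def)
  have "x \<bullet> ?p = (\<Sum>k\<in>UNIV. x $ k * ?p $ k)" by (simp add: inner_vec_def)
  also have "\<dots> = - 2 * c * (\<Sum>k\<in>UNIV. x $ k) + 5 * c * (x $ i + x $ j)"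
    unfolding p distrib_left sum.distrib sum_distrib_left
    by (simp add: if_distrib cong: if_cong) (simp add: algebra_simps)
  also have "\<dots> = 5 * c * (x $ i + x $ j)" using assms(1) by (simp add: mem_A3)
  finally have xp: "x \<bullet> ?p = 5 * c * (x $ i + x $ j)" .
  have "?p \<in> A3 c" using assms(2,3) by (intro two_valued_in_A3) auto
  then have "?p \<bullet> ?p = 1" "x \<bullet> x = 1"
    using assms(1) by (simp_all add: mem_A3 inner_vec_def power2_eq_square)
  then show ?thesis
    unfolding dist_norm power2_norm_eq_inner
    by (simp add: inner_diff_left inner_diff_right inner_commute[of ?p x] xp)
qed

text \<open>Otherwise the squared distance of \<open>dist_two_valued\<close> would be negative,
  since 60 c^2 = 2.\<close>

lemma not_two_coordinates_above:
  assumes "x \<in> A3 C" "c > 0" "c\<^sup>2 = 1/30" "i \<noteq> j" "x $ i > 3 * c"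
  shows "x $ j < 3 * c"
proof (rule ccontr)
  assume "\<not> x $ j < 3 * c"
  then have "10 * c * (x $ i + x $ j) > 10 * c * (6 * c)"
    using assms by (intro mult_strict_left_mono) auto
  also have "10 * c * (6 * c) = 2" using assms(3) by (simp add: power2_eq_square)
  finally show False
    using dist_two_valued[OF assms(1,3,4)] zero_le_power2[of "dist x (two_valued c {i, j})"] by linarith
qed

lemma two_coordinates_ge_iff:
  assumes "c > 0" "c\<^sup>2 = 1/30" "i \<noteq> j"
  shows "x \<in> A3 c \<and> x $ i \<ge> 3 * c \<and> x $ j \<ge> 3 * c \<longleftrightarrow> x = two_valued c {i, j}"
proof
  assume x: "x \<in> A3 c \<and> x $ i \<ge> 3 * c \<and> x $ j \<ge> 3 * c"
  then have "10 * c * (x $ i + x $ j) \<ge> 10 * c * (6 * c)"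
    using assms(1) by (intro mult_left_mono) auto
  also have "10 * c * (6 * c) = 2" using assms(2) by (simp add: power2_eq_square)
  finally have "(dist x (two_valued c {i, j}))\<^sup>2 \<le> 0"
    using dist_two_valued[OF conjunct1[OF x] assms(2,3)] by linarith
  then show "x = two_valued c {i, j}" by simp
next
  assume x: "x = two_valued c {i, j}"
  then have "x \<in> A3 c" using assms two_valued_in_A3[of "{i, j}" c] by simp
  then show "x \<in> A3 c \<and> x $ i \<ge> 3 * c \<and> x $ j \<ge> 3 * c"
    using x by (simp add: two_valued_def)
qed

section \<open>Parametrising a lobe by the sphere\<close>

text \<open>A multiple of (4,-1,-1,-1,-1), scaled to first coordinate 1; its squared norm 5/4 is the
  coefficient in \<open>radius\<close>.\<close>

definition pole :: "real ^ 5" where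
  "pole = (\<chi> i. if i = 0 then 1 else - 1/4)"

text \<open>The rows of a 4 by 4 Hadamard matrix without its constant column: in these coordinates on the
  hyperplane of sum zero in 4-space, the cubic power sum becomes \<open>3 y\<^sub>1 y\<^sub>2 y\<^sub>3\<close>.\<close>

definition tetra :: "real ^ 3 \<Rightarrow> real ^ 5" where
  "tetra y = (\<chi> i. if i = 0 then 0
     else if i = 1 then (y $ 1 + y $ 2 + y $ 3) / 2
     else if i = 2 then (y $ 1 - y $ 2 - y $ 3) / 2
     else if i = 3 then (- y $ 1 + y $ 2 - y $ 3) / 2
     else (- y $ 1 - y $ 2 + y $ 3) / 2)"

text \<open>The adjoint of \<open>tetra\<close>. The columns of \<open>tetra\<close> are orthonormal
  and orthogonal to \<open>pole\<close>, so this is a left inverse of \<open>tetra\<close> that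
  kills \<open>pole\<close>.\<close>

definition untetra :: "real ^ 5 \<Rightarrow> real ^ 3" where
  "untetra x = (\<chi> i. if i = 1 then (x $ 1 + x $ 2 - x $ 3 - x $ 4) / 2
     else if i = 2 then (x $ 1 - x $ 2 + x $ 3 - x $ 4) / 2
     else (x $ 1 - x $ 2 - x $ 3 + x $ 4) / 2)"

lemma pole_nth: "pole $ 0 = 1" "pole $ 1 = - 1/4" "pole $ 2 = - 1/4" "pole $ 3 = - 1/4" "pole $ 4 = - 1/4"
  by (simp_all add: pole_def)

lemma tetra_nth:
  "tetra y $ 0 = 0" "tetra y $ 1 = (y $ 1 + y $ 2 + y $ 3) / 2"
  "tetra y $ 2 = (y $ 1 - y $ 2 - y $ 3) / 2" "tetra y $ 3 = (- y $ 1 + y $ 2 - y $ 3) / 2"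
  "tetra y $ 4 = (- y $ 1 - y $ 2 + y $ 3) / 2"
  by (simp_all add: tetra_def)

lemma untetra_nth:
  "untetra x $ 1 = (x $ 1 + x $ 2 - x $ 3 - x $ 4) / 2"
  "untetra x $ 2 = (x $ 1 - x $ 2 + x $ 3 - x $ 4) / 2"
  "untetra x $ 3 = (x $ 1 - x $ 2 - x $ 3 + x $ 4) / 2"
  by (simp_all add: untetra_def)

lemma bounded_linear_tetra: "bounded_linear tetra"
  by (intro linear_conv_bounded_linear[THEN iffD1] linearI)
    (simp_all add: vec_eq_iff forall_5 tetra_nth field_simps)

lemma bounded_linear_untetra: "bounded_linear untetra"
  by (intro linear_conv_bounded_linear[THEN iffD1] linearI)
    (simp_all add: vec_eq_iff forall_3 untetra_nth field_simps)

lemma untetra_combination: "untetra (s *\<^sub>R pole + r *\<^sub>R tetra y) = r *\<^sub>R y"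
  by (simp add: vec_eq_iff forall_3 untetra_nth pole_nth tetra_nth field_simps)

text \<open>Subtracting \<open>(x $ 0) *\<^sub>R pole\<close> leaves a vector with coordinate 0
  equal to zero and coordinate sum zero, hence in the range of \<open>tetra\<close>.\<close>

lemma pole_tetra_decomposition:
  assumes "(\<Sum>i\<in>UNIV. x $ i) = 0"
  shows "x = (x $ 0) *\<^sub>R pole + tetra (untetra x)"
  using assms unfolding sum_5
  by (simp add: vec_eq_iff forall_5 untetra_nth pole_nth tetra_nth field_simps)

lemma norm_power2_3: "(norm (y :: real ^ 3))\<^sup>2 = (y $ 1)\<^sup>2 + (y $ 2)\<^sup>2 + (y $ 3)\<^sup>2"
  unfolding power2_norm_eq_inner by (simp add: inner_vec_def sum_3 power2_eq_square)

text \<open>\<open>tetra\<close> is isometric with image orthogonal to \<open>pole\<close>. In the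
  cubic sum, 15/16 = 1 - 4/64, the mixed term in t^2 vanishes with the coordinate sum of
  \<open>tetra y\<close>, and the one in t is 3 * (-1/4) times the squared norm.\<close>

lemma power_sums_combination:
  fixes t :: real
  shows "(\<Sum>i\<in>UNIV. (t *\<^sub>R pole + tetra y) $ i) = 0"
    "(\<Sum>i\<in>UNIV. ((t *\<^sub>R pole + tetra y) $ i)\<^sup>2) = 5/4 * t\<^sup>2 + (norm y)\<^sup>2"
    "(\<Sum>i\<in>UNIV. ((t *\<^sub>R pole + tetra y) $ i) ^ 3)
      = 15/16 * t ^ 3 - 3/4 * t * (norm y)\<^sup>2 + 3 * (y $ 1 * y $ 2 * y $ 3)"
  unfolding norm_power2_3 sum_5
  by (simp_all add: pole_nth tetra_nth field_simps eval_nat_numeral)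

definition cubic3 :: "real ^ 3 \<Rightarrow> real" where
  "cubic3 y = 3 * (y $ 1 * y $ 2 * y $ 3)"

text \<open>The inequality of arithmetic and geometric means for the squared coordinates gives (y1
  y2 y3)^2 \<le> 1/27. This is the source of the bound \<open>q \<le> 1 / sqrt 3\<close> on the
  cubic sums along great circles.\<close>

lemma cubic3_le:
  assumes "norm y = 1"
  shows "cubic3 y \<le> 1 / sqrt 3"
proof -
  have amgm: "27 * (a * b * c) \<le> (a + b + c) ^ 3" if "a \<ge> 0" "b \<ge> 0" "c \<ge> 0" for a b c :: real
  proof -
    have "(a + b + c) ^ 3 - 27 * (a * b * c) =
      (a + b + c) / 2 * ((a - b)\<^sup>2 + (b - c)\<^sup>2 + (a - c)\<^sup>2)
      + 3 * (a * (b - c)\<^sup>2 + b * (a - c)\<^sup>2 + c * (a - b)\<^sup>2)"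
      by (simp add: field_simps eval_nat_numeral)
    moreover have "\<dots> \<ge> 0" using that by simp
    ultimately show ?thesis by linarith
  qed
  have "(y $ 1)\<^sup>2 + (y $ 2)\<^sup>2 + (y $ 3)\<^sup>2 = 1"
    using norm_power2_3[of y] assms by simp
  then have "27 * ((y $ 1)\<^sup>2 * (y $ 2)\<^sup>2 * (y $ 3)\<^sup>2) \<le> 1"
    using amgm[of "(y $ 1)\<^sup>2" "(y $ 2)\<^sup>2" "(y $ 3)\<^sup>2"] by simp
  then have "(cubic3 y)\<^sup>2 \<le> (1 / sqrt 3)\<^sup>2"
    by (simp add: cubic3_def power_mult_distrib power_divide)
  then show ?thesis by (rule power2_le_imp_le) simp
qed

definition ray_point :: "real \<Rightarrow> real ^ 3 \<Rightarrow> real ^ 5" where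
  "ray_point w y = inverse (radius w) *\<^sub>R (w *\<^sub>R pole + tetra y)"

lemma ray_point_in_A3:
  assumes "norm y = 1"
  shows "ray_point w y \<in> A3 (ray_cubic w (cubic3 y))"
proof -
  let ?r = "inverse (radius w)"
  note sums = power_sums_combination[of w y]
  have "(\<Sum>i\<in>UNIV. ray_point w y $ i) = ?r * (\<Sum>i\<in>UNIV. (w *\<^sub>R pole + tetra y) $ i)"
    unfolding ray_point_def sum_distrib_left by simp
  also have "\<dots> = 0" unfolding sums by simp
  finally have 1: "(\<Sum>i\<in>UNIV. ray_point w y $ i) = 0" .
  have "(\<Sum>i\<in>UNIV. (ray_point w y $ i)\<^sup>2) = ?r\<^sup>2 * (\<Sum>i\<in>UNIV. ((w *\<^sub>R pole + tetra y) $ i)\<^sup>2)"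
    unfolding ray_point_def sum_distrib_left by (simp only: vector_scaleR_component real_scaleR_def power_mult_distrib)
  also have "\<dots> = ?r\<^sup>2 * (radius w)\<^sup>2" unfolding sums radius_power2 assms by simp
  also have "\<dots> = 1" using radius_pos[of w] by (simp add: power_mult_distrib[symmetric])
  finally have 2: "(\<Sum>i\<in>UNIV. (ray_point w y $ i)\<^sup>2) = 1" .
  have "(\<Sum>i\<in>UNIV. (ray_point w y $ i) ^ 3) = ?r ^ 3 * (\<Sum>i\<in>UNIV. ((w *\<^sub>R pole + tetra y) $ i) ^ 3)"
    unfolding ray_point_def sum_distrib_left by (simp only: vector_scaleR_component real_scaleR_def power_mult_distrib)
  also have "\<dots> = ray_cubic w (cubic3 y)"
    unfolding sums assms ray_cubic_def cubic3_def by (simp add: field_simps)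
  finally show ?thesis
    using 1 2 by (simp add: mem_A3)
qed

lemma untetra_ray_point: "untetra (ray_point w y) = inverse (radius w) *\<^sub>R y"
  using untetra_combination[of "inverse (radius w) * w" "inverse (radius w)" y]
  by (simp add: ray_point_def scaleR_add_right)

text \<open>Recovers the sphere parameter of \<open>ray_point\<close>; on the axis of
  \<open>pole\<close>, where \<open>untetra\<close> vanishes, the value is 0.\<close>

definition direction :: "real ^ 5 \<Rightarrow> real ^ 3" where
  "direction x = inverse (norm (untetra x)) *\<^sub>R untetra x"

lemma norm_direction: "untetra x \<noteq> 0 \<Longrightarrow> norm (direction x) = 1"
  by (simp add: direction_def)

lemma direction_ray_point:
  assumes "norm y = 1"
  shows "direction (ray_point w y) = y"
  using radius_pos[of w] assms by (simp add: direction_def untetra_ray_point)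

lemma ray_point_direction:
  assumes "x \<in> A3 C" "untetra x \<noteq> 0"
  shows "ray_point (x $ 0 / norm (untetra x)) (direction x) = x"
proof -
  let ?s = "norm (untetra x)"
  have dec: "x = (x $ 0) *\<^sub>R pole + tetra (untetra x)"
    using assms(1) pole_tetra_decomposition[of x] by (simp add: mem_A3)
  have s: "?s > 0" using assms(2) by simp
  \<comment> \<open>Dividing the unit norm equation by the square of \<open>?s\<close> identifies
    \<open>?s\<close> as the reciprocal of the radius.\<close>
  have "5/4 * (x $ 0)\<^sup>2 + ?s\<^sup>2 = 1"
    using assms(1) power_sums_combination(2)[of "x $ 0" "untetra x"] dec by (simp add: mem_A3)
  then have "(radius (x $ 0 / ?s))\<^sup>2 = (inverse ?s)\<^sup>2"
    unfolding radius_power2 using s by (simp add: field_simps)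
  then have "radius (x $ 0 / ?s) = inverse ?s"
    using radius_pos[of "x $ 0 / ?s"] s by (simp add: power2_eq_iff_nonneg)
  then have "ray_point (x $ 0 / ?s) (direction x) = (x $ 0) *\<^sub>R pole + tetra (?s *\<^sub>R direction x)"
    using s linear_cmul[OF bounded_linear.linear[OF bounded_linear_tetra]]
    by (simp add: ray_point_def scaleR_add_right)
  also have "?s *\<^sub>R direction x = untetra x"
    using s by (simp add: direction_def)
  finally show ?thesis using dec by simp
qed

text \<open>Otherwise \<open>x\<close> is the unit multiple of \<open>pole\<close> with nonnegative
  first coordinate, whose cubic power sum is the excluded value \<open>3 / sqrt 20\<close>.\<close>

lemma untetra_nonzero:
  assumes "x \<in> A3 C" "C < 3 / sqrt 20"  "x $ 0 \<ge> 0"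
  shows "untetra x \<noteq> 0"
proof
  assume 0: "untetra x = 0"
  have dec: "x = (x $ 0) *\<^sub>R pole + tetra 0"
    using assms(1) pole_tetra_decomposition[of x] 0 by (simp add: mem_A3)
  have "5/4 * (x $ 0)\<^sup>2 = 1"
    using assms(1) power_sums_combination(2)[of "x $ 0" 0] dec by (simp add: mem_A3)
  then have sq: "(x $ 0)\<^sup>2 = 4/5" by simp
  have "C = 15/16 * (x $ 0) ^ 3"
    using assms(1) power_sums_combination(3)[of "x $ 0" 0] dec by (simp add: mem_A3)
  also have "\<dots> = 3/4 * x $ 0"
    using sq by (simp add: power3_eq_cube power2_eq_square)
  finally have C: "C = 3/4 * x $ 0" .
  then have "C\<^sup>2 = 9/20" unfolding C power_mult_distrib sq by (simp add: power2_eq_square)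
  then have "C\<^sup>2 = (3 / sqrt 20)\<^sup>2" by (simp add: power_divide)
  then have "C = 3 / sqrt 20"
    using C assms(3) by (simp add: power2_eq_iff_nonneg)
  then show False using assms(2) by simp
qed

text \<open>The first coordinate is \<open>w / radius w\<close>; for \<open>w \<ge> 0\<close>
  squaring turns the condition into w^2 \<ge> 12/25, the square of \<open>w_crit\<close>.\<close>

lemma ray_point_0_ge_iff: "ray_point w y $ 0 \<ge> 3 / sqrt 30 \<longleftrightarrow> w \<ge> w_crit"
proof -
  have x0: "ray_point w y $ 0 = w / radius w"
    by (simp add: ray_point_def pole_nth tetra_nth field_simps)
  show ?thesis
  proof (cases "w \<ge> 0")
    case False
    then have "w / radius w < 0" "w < w_crit"
      using radius_pos[of w] w_crit_pos by (auto simp: divide_neg_pos)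
    moreover have "0 \<le> 3 / sqrt 30" by simp
    ultimately show ?thesis unfolding x0 by linarith
  next
    case True
    have "3 / sqrt 30 \<le> w / radius w \<longleftrightarrow> (3 / sqrt 30)\<^sup>2 \<le> (w / radius w)\<^sup>2"
      using True radius_pos[of w] by (intro power_mono_iff[symmetric]) (simp_all add: less_imp_le)
    also have "\<dots> \<longleftrightarrow> 3/10 * (radius w)\<^sup>2 \<le> w\<^sup>2"
      using radius_pos[of w] by (simp add: power_divide field_simps)
    also have "\<dots> \<longleftrightarrow> 12/25 \<le> w\<^sup>2"
      unfolding radius_power2 by (simp add: field_simps)
    also have "\<dots> \<longleftrightarrow> w_crit\<^sup>2 \<le> w\<^sup>2"
      by (simp add: w_crit_def power_mult_distrib power_divide)
    also have "\<dots> \<longleftrightarrow> w_crit \<le> w"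
      using True w_crit_pos by (simp add: power_mono_iff)
    finally show ?thesis unfolding x0 .
  qed
qed

text \<open>The description is proper for unit \<open>y\<close> and
  \<open>1 / sqrt 30 \<le> C < 3 / sqrt 20\<close>, by \<open>ex1_ray_cubic_eq\<close> and
  \<open>cubic3_le\<close>.\<close>

definition height :: "real \<Rightarrow> real ^ 3 \<Rightarrow> real" where
  "height C y = (THE w. w \<ge> w_crit \<and> ray_cubic w (cubic3 y) = C)"

text \<open>\<open>direction\<close> and y -> \<open>ray_point (height C y) y\<close> are mutually
  inverse: a point of the lobe has ray parameter \<open>x $ 0 / norm (untetra x)\<close>, and
  uniqueness identifies it with the height.\<close>

lemma lobe_0_parametrisation:
  assumes "1 / sqrt 30 \<le> C" "C < 3 / sqrt 20"
  shows "x \<in> lobe C 0 \<Longrightarrow> untetra x \<noteq> 0"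
    "x \<in> lobe C 0 \<Longrightarrow> direction x \<in> sphere 0 1"
    "x \<in> lobe C 0 \<Longrightarrow> ray_point (height C (direction x)) (direction x) = x"
    "y \<in> sphere 0 1 \<Longrightarrow> ray_point (height C y) y \<in> lobe C 0"
    "y \<in> sphere 0 1 \<Longrightarrow> height C y \<ge> w_crit \<and> ray_cubic (height C y) (cubic3 y) = C"
    "y \<in> sphere 0 1 \<Longrightarrow> w \<ge> w_crit \<Longrightarrow> ray_cubic w (cubic3 y) = C \<Longrightarrow> height C y = w"
proof -
  have ex1: "\<exists>!w. w \<ge> w_crit \<and> ray_cubic w (cubic3 y) = C" if "y \<in> sphere 0 1" for y
    using that ex1_ray_cubic_eq[OF assms cubic3_le] by simp
  show H: "height C y \<ge> w_crit \<and> ray_cubic (height C y) (cubic3 y) = C" if "y \<in> sphere 0 1" for y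
    unfolding height_def by (rule theI'[OF ex1[OF that]])
  show U: "height C y = w" if "y \<in> sphere 0 1" "w \<ge> w_crit" "ray_cubic w (cubic3 y) = C" for w y
    unfolding height_def by (rule the1_equality[OF ex1[OF that(1)]]) (use that in simp)
  show "ray_point (height C y) y \<in> lobe C 0" if "y \<in> sphere 0 1"
    using that H[OF that] ray_point_in_A3[of y "height C y"]
    by (simp add: lobe_def ray_point_0_ge_iff)
  assume x: "x \<in> lobe C 0"
  then have xA: "x \<in> A3 C" and x0: "x $ 0 \<ge> 3 / sqrt 30" by (simp_all add: lobe_def)
  have "x $ 0 \<ge> 0" using x0 by (rule order_trans[rotated]) simp
  then show nz: "untetra x \<noteq> 0" using untetra_nonzero xA assms(2) by blast
  then show d: "direction x \<in> sphere 0 1" by (simp add: norm_direction)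
  let ?w = "x $ 0 / norm (untetra x)"
  have rp: "ray_point ?w (direction x) = x" by (rule ray_point_direction[OF xA nz])
  have "?w \<ge> w_crit" using ray_point_0_ge_iff[of ?w "direction x"] x0 rp by simp
  moreover have "ray_cubic ?w (cubic3 (direction x)) = C"
    using ray_point_in_A3[of "direction x" ?w] d rp xA by (simp add: mem_A3)
  ultimately have "height C (direction x) = ?w" by (rule U[OF d])
  then show "ray_point (height C (direction x)) (direction x) = x" using rp by simp
qed

lemma open_untetra_nonzero: "open {x. untetra x \<noteq> 0}"
  by (intro open_Collect_neq continuous_intros linear_continuous_on bounded_linear_untetra)

lemma C_infinity_on_direction: "C_infinity_on {x. untetra x \<noteq> 0} direction"
  unfolding direction_def norm_eq_sqrt_inner
  by (intro C_infinity_on_scaleR C_infinity_on_inverse C_infinity_on_sqrt C_infinity_on_inner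
      C_infinity_on_linear bounded_linear_untetra open_untetra_nonzero) auto

lemma compact_lobe: "compact (lobe C i)"
proof -
  have "norm x = 1" if "x \<in> A3 C" for x
    using that by (simp add: norm_eq_sqrt_inner inner_vec_def mem_A3 power2_eq_square)
  then have "lobe C i \<subseteq> cball 0 1" by (auto simp: lobe_def)
  then have "bounded (lobe C i)" using bounded_subset bounded_cball by blast
  moreover have "closed (lobe C i)"
  proof -
    have "lobe C i = {x. (\<Sum>i\<in>UNIV. x $ i) = 0} \<inter> {x. (\<Sum>i\<in>UNIV. (x $ i)\<^sup>2) = 1}
        \<inter> {x. (\<Sum>i\<in>UNIV. (x $ i) ^ 3) = C} \<inter> {x. x $ i \<ge> 3 / sqrt 30}"
      by (auto simp: lobe_def mem_A3)
    then show ?thesis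
      by (simp only:) (intro closed_Int closed_Collect_eq closed_Collect_le continuous_intros)
  qed
  ultimately show ?thesis by (simp add: compact_eq_bounded_closed)
qed

text \<open>A continuous bijection from a compact set is a homeomorphism. This includes
  \<open>C = 1 / sqrt 30\<close>, where the slope vanishes at the solutions
  \<open>w = w_crit\<close>.\<close>

lemma lobe_0_homeomorphic_sphere:
  assumes "1 / sqrt 30 \<le> C" "C < 3 / sqrt 20"
  shows "lobe C 0 homeomorphic sphere (0 :: real ^ 3) 1"
proof (rule homeomorphic_compact[OF compact_lobe])
  note b = lobe_0_parametrisation[OF assms]
  have "continuous_on {x. untetra x \<noteq> 0} direction"
    using C_infinity_on_direction C_infinity_on_imp_continuous_on by blast
  then show "continuous_on (lobe C 0) direction"
    by (rule continuous_on_subset) (use b(1) in blast)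
  show "inj_on direction (lobe C 0)"
    by (rule inj_on_inverseI[where g = "\<lambda>y. ray_point (height C y) y"]) (rule b(3))
  show "direction ` lobe C 0 = sphere 0 1"
  proof (intro equalityI subsetI)
    fix y :: "real ^ 3" assume y: "y \<in> sphere 0 1"
    show "y \<in> direction ` lobe C 0"
      using image_eqI[OF _ b(4)[OF y], of y direction] direction_ray_point y by simp
  qed (use b(2) in blast)
qed

section \<open>Smooth dependence of the height on the direction\<close>

text \<open>Solving \<open>ray_cubic w q = C\<close> for \<open>q\<close> reduces the smooth dependence of \<open>w\<close> on the
  direction to inverting a function of one variable.\<close>

definition balance :: "real \<Rightarrow> real \<Rightarrow> real" where
  "balance C w = C * radius w ^ 3 - 15/16 * w ^ 3 + 3/4 * w"

definition balance' :: "real \<Rightarrow> real \<Rightarrow> real" where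
  "balance' C w = 15/4 * C * (w * radius w) - 45/16 * w\<^sup>2 + 3/4"

lemma balance_eq_iff: "balance C w = q \<longleftrightarrow> ray_cubic w q = C"
  using radius_pos[of w] by (auto simp: balance_def ray_cubic_def field_simps)

lemma balance_has_derivative: "(balance C has_real_derivative balance' C w) (at w)"
  unfolding balance_def [abs_def] balance'_def using radius_pos[of w]
  by (auto intro!: derivative_eq_intros radius_has_derivative simp: field_simps power2_eq_square)

lemma C_infinity_on_radius: "C_infinity_on UNIV radius"
  unfolding radius_def [abs_def]
  by (intro C_infinity_on_sqrt C_infinity_on_add C_infinity_on_mult C_infinity_on_power
      C_infinity_on_const C_infinity_on_linear bounded_linear_ident open_UNIV)
    (simp add: add_pos_nonneg)

lemma C_infinity_on_balance': "C_infinity_on UNIV (balance' C)"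
  unfolding balance'_def [abs_def]
  by (intro C_infinity_on_radius C_infinity_on_add C_infinity_on_diff C_infinity_on_mult
      C_infinity_on_power C_infinity_on_const C_infinity_on_linear bounded_linear_ident open_UNIV)

text \<open>Multiplying by the squared radius and eliminating \<open>C\<close> through the equation
  gives minus the numerator of the slope of \<open>ray_cubic\<close>.\<close>

lemma balance'_neg:
  assumes "ray_cubic w q = C" "w > w_crit" "q \<le> 1 / sqrt 3"
  shows "balance' C w < 0"
proof -
  have C: "C * radius w ^ 3 = 15/16 * w ^ 3 - 3/4 * w + q"
    using assms(1) radius_pos[of w] by (auto simp: ray_cubic_def field_simps)
  have "(radius w)\<^sup>2 * balance' C w = 15/4 * w * (C * radius w ^ 3) - (45/16 * w\<^sup>2 - 3/4) * (radius w)\<^sup>2"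
    by (simp add: balance'_def algebra_simps eval_nat_numeral)
  also have "\<dots> = - (75/16 * w\<^sup>2 - 3/4 - 15/4 * w * q)"
    unfolding C radius_power2 by (simp add: field_simps eval_nat_numeral)
  also have "\<dots> < 0" using ray_cubic_slope_pos[OF assms(2,3)] by simp
  finally show ?thesis using radius_pos[of w] by (simp add: mult_less_0_iff)
qed

lemma C_infinity_on_ray_point:
  assumes "open U" "C_infinity_on U f"
  shows "C_infinity_on U (\<lambda>y. ray_point (f y) y)"
proof -
  have r: "C_infinity_on U (\<lambda>y. radius (f y))"
    by (rule C_infinity_on_compose[OF assms(1) open_UNIV assms(2) C_infinity_on_radius]) simp
  have nz: "radius (f y) \<noteq> 0" for y
    using radius_pos[of "f y"] by simp
  show ?thesis
    unfolding ray_point_def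
    by (intro C_infinity_on_scaleR C_infinity_on_add C_infinity_on_inverse r nz assms
        C_infinity_on_const C_infinity_on_linear[OF bounded_linear_tetra])
qed

lemma C_infinity_on_cubic3: "C_infinity_on UNIV cubic3"
  unfolding cubic3_def [abs_def]
  by (intro C_infinity_on_mult C_infinity_on_const C_infinity_on_linear bounded_linear_vec_nth open_UNIV)

lemma smooth_on_ray_point_height:
  assumes "1 / sqrt 30 < C" "C < 3 / sqrt 20"
  shows "smooth_on (sphere 0 1) (\<lambda>y. ray_point (height C y) y)"
  unfolding smooth_on_def
proof
  fix y0 :: "real ^ 3" assume y0: "y0 \<in> sphere 0 1"
  have le: "1 / sqrt 30 \<le> C" using assms(1) by simp
  note b = lobe_0_parametrisation[OF le assms(2)]
  let ?w = "height C y0"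
  have w: "ray_cubic ?w (cubic3 y0) = C" "?w \<ge> w_crit"
    using b(5)[OF y0] by simp_all
  have q: "cubic3 y0 \<le> 1 / sqrt 3" using cubic3_le y0 by simp
  \<comment> \<open>Here the strict bound on \<open>C\<close> enters: at \<open>w_crit\<close> the
    value is at most \<open>1 / sqrt 30\<close>.\<close>
  have "?w \<noteq> w_crit"
    using w(1) ray_cubic_w_crit_le[OF q] assms(1) by auto
  then have w_gt: "?w > w_crit" using w(2) by simp
  \<comment> \<open>The derivative condition makes \<open>balance C\<close> locally invertible;
    staying above \<open>w_crit\<close> lets the local inverse be recognised as the height.\<close>
  let ?G = "{w. balance' C w < 0} \<inter> {w_crit<..}"
  have "open ?G"
    by (intro open_Int open_Collect_less C_infinity_on_imp_continuous_on[OF C_infinity_on_balance']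
        continuous_on_const) simp
  moreover have "?w \<in> ?G" using balance'_neg[OF w(1) w_gt q] w_gt by simp
  ultimately obtain d where d: "d > 0" "ball ?w d \<subseteq> ?G" by (rule openE)
  let ?S = "ball ?w d"
  have inj: "inj_on (balance C) ?S"
  proof (rule linorder_inj_onI)
    fix u v assume uv: "u < v" "u \<in> ?S" "v \<in> ?S"
    have "balance C v < balance C u"
    proof (rule DERIV_neg_imp_decreasing[OF uv(1)])
      fix t assume "u \<le> t" "t \<le> v"
      then have "t \<in> ?S" using uv by (auto simp: dist_real_def)
      then show "\<exists>y. (balance C has_real_derivative y) (at t) \<and> y < 0"
        using d(2) balance_has_derivative by blast
    qed
    then show "balance C u \<noteq> balance C v" by simp
  qed auto
  let ?V = "balance C ` ?S"
  let ?h = "inv_into ?S (balance C)"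
  have nz: "balance' C u \<noteq> 0" if "u \<in> ?S" for u using that d(2) by force
  have V: "open ?V" "C_infinity_on ?V ?h"
    using open_image_and_C_infinity_on_inverse_real[OF open_ball balance_has_derivative
        C_infinity_on_mono[OF C_infinity_on_balance' subset_UNIV] nz inj] by simp_all
  let ?U = "cubic3 -` ?V"
  have op: "open ?U"
    using C_infinity_on_imp_continuous_on[OF C_infinity_on_cubic3] V(1)
    by (simp add: open_vimage)
  have "cubic3 y0 = balance C ?w" using w(1) balance_eq_iff by metis
  then have "y0 \<in> ?U" using d(1) by simp
  moreover have "C_infinity_on ?U (\<lambda>y. ray_point (?h (cubic3 y)) y)"
    by (intro C_infinity_on_ray_point op C_infinity_on_compose[OF op V(1) _ V(2)]
        C_infinity_on_mono[OF C_infinity_on_cubic3 subset_UNIV]) auto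
  \<comment> \<open>The local inverse solves the equation defining the height and exceeds
    \<open>w_crit\<close>, so uniqueness makes the two agree on the sphere.\<close>
  moreover have "ray_point (?h (cubic3 y)) y = ray_point (height C y) y"
    if "y \<in> sphere 0 1 \<inter> ?U" for y
  proof -
    have "cubic3 y \<in> ?V" using that by simp
    then have "?h (cubic3 y) \<in> ?S" "balance C (?h (cubic3 y)) = cubic3 y"
      by (rule inv_into_into, rule f_inv_into_f)
    then have "?h (cubic3 y) \<ge> w_crit" "ray_cubic (?h (cubic3 y)) (cubic3 y) = C"
      using d(2) by (auto simp: balance_eq_iff)
    then show ?thesis using b(6)[of y] that by simp
  qed
  ultimately show "\<exists>U g. open U \<and> y0 \<in> U \<and> C_infinity_on U g \<and>
      (\<forall>y\<in>sphere 0 1 \<inter> U. g y = ray_point (height C y) y)"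
    using op by (intro exI[of _ ?U] exI[of _ "\<lambda>y. ray_point (?h (cubic3 y)) y"]) simp
qed

lemma lobe_0_diffeomorphic_sphere:
  assumes "1 / sqrt 30 < C" "C < 3 / sqrt 20"
  shows "diffeomorphic (lobe C 0) (sphere (0 :: real ^ 3) 1)"
proof (rule diffeomorphicI[where g = "\<lambda>y. ray_point (height C y) y"])
  have le: "1 / sqrt 30 \<le> C" using assms(1) by simp
  note b = lobe_0_parametrisation[OF le assms(2)]
  show "smooth_on (lobe C 0) direction"
    by (rule smooth_onI_C_infinity[OF open_untetra_nonzero _ C_infinity_on_direction]) (use b(1) in blast)
  show "smooth_on (sphere 0 1) (\<lambda>y. ray_point (height C y) y)"
    by (rule smooth_on_ray_point_height[OF assms])
  show "direction ` lobe C 0 \<subseteq> sphere 0 1" using b(2) by blast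
  show "(\<lambda>y. ray_point (height C y) y) ` sphere 0 1 \<subseteq> lobe C 0" using b(4) by blast
  show "ray_point (height C (direction x)) (direction x) = x" if "x \<in> lobe C 0" for x
    using b(3)[OF that] .
  show "direction (ray_point (height C y) y) = y" if "y \<in> sphere 0 1" for y
    using direction_ray_point that by simp
qed

section \<open>Transport to all five lobes and assembly of the level sets for both signs of
  C\<close>

section \<open>The level sets\<close>

text \<open>Swapping coordinates 0 and \<open>i\<close> is a linear involution preserving all power
  sums.\<close>

lemma lobe_permute:
  fixes i :: 5
  obtains f :: "real ^ 5 \<Rightarrow> real ^ 5" where "bounded_linear f" "\<And>x. f (f x) = x" "f ` lobe C 0 = lobe C i"
proof -
  let ?t = "Transposition.transpose 0 i"
  let ?f = "\<lambda>x :: real ^ 5. (\<chi> j. x $ ?t j) :: real ^ 5"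
  have lin: "bounded_linear ?f"
    by (intro linear_conv_bounded_linear[THEN iffD1] linearI) (simp_all add: vec_eq_iff)
  have inv: "?f (?f x) = x" for x
    by (simp add: vec_eq_iff)
  have bij: "bij ?t"
    by (rule involuntory_imp_bij) simp
  have "(\<Sum>j\<in>UNIV. g (?f x $ j)) = (\<Sum>j\<in>UNIV. g (x $ j))" for g :: "real \<Rightarrow> real" and x
    using sum.reindex_bij_betw[OF bij, of "\<lambda>j. g (x $ j)"] by simp
  note sums = this[of "\<lambda>t. t"] this[of power2] this[of "\<lambda>t. t ^ 3"]
  have A3: "?f x \<in> A3 C \<longleftrightarrow> x \<in> A3 C" for x
    using sums[of x] by (simp add: mem_A3)
  have "?f ` lobe C 0 = lobe C i"
  proof (intro equalityI subsetI)
    fix x assume "x \<in> lobe C i"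
    then have "?f x \<in> lobe C 0"
      using A3[of x] by (simp add: lobe_def)
    then show "x \<in> ?f ` lobe C 0"
      using image_eqI[of x ?f "?f x"] inv[of x] by simp
  next
    fix y assume "y \<in> ?f ` lobe C 0"
    then obtain x where "x \<in> lobe C 0" "y = ?f x" by blast
    then show "y \<in> lobe C i"
      using A3[of x] by (simp add: lobe_def)
  qed
  with lin inv show ?thesis by (rule that)
qed

lemma lobe_diffeomorphic_sphere:
  assumes "1 / sqrt 30 < C" "C < 3 / sqrt 20"
  shows "diffeomorphic (lobe C i) (sphere (0 :: real ^ 3) 1)"
proof -
  obtain f where f: "bounded_linear f" "\<And>x. f (f x) = x" "f ` lobe C 0 = lobe C i"
    using lobe_permute by blast
  have "diffeomorphic (lobe C 0) (lobe C i)"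
    using diffeomorphic_linear_image[OF f(1,1,2), of "lobe C 0"] by (simp add: f(3))
  then show ?thesis
    using diffeomorphic_sym diffeomorphic_trans lobe_0_diffeomorphic_sphere[OF assms] by blast
qed

lemma lobe_homeomorphic_sphere:
  assumes "1 / sqrt 30 \<le> C" "C < 3 / sqrt 20"
  shows "lobe C i homeomorphic sphere (0 :: real ^ 3) 1"
proof -
  obtain f where f: "bounded_linear f" "\<And>x. f (f x) = x" "f ` lobe C 0 = lobe C i"
    using lobe_permute by blast
  have "lobe C 0 homeomorphic lobe C i"
    using homeomorphic_compact[OF compact_lobe linear_continuous_on[OF f(1)] f(3)] f(2)
    by (metis inj_on_inverseI)
  then show ?thesis
    using homeomorphic_sym homeomorphic_trans lobe_0_homeomorphic_sphere[OF assms] by blast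
qed

lemma inverse_sqrt_30:
  "1 / sqrt 30 > 0" "(1 / sqrt 30)\<^sup>2 = 1/30" "3 / sqrt 30 = 3 * (1 / sqrt 30)"
  by (simp_all add: power_divide)

lemma A3_eq_Union_lobes:
  assumes "1 / sqrt 30 \<le> C"
  shows "A3 C = (\<Union>i. lobe C i)"
  using exists_large_coordinate(1)[OF _ inverse_sqrt_30(1,2) assms]
  by (auto simp: lobe_def)

text \<open>At equality some coordinate still exceeds the threshold strictly, necessarily another
  one; but then coordinate \<open>i\<close> lies strictly below it.\<close>

lemma lobe_strict:
  assumes "1 / sqrt 30 < C" "x \<in> lobe C i"
  shows "x $ i > 3 / sqrt 30"
proof (rule ccontr)
  assume "\<not> x $ i > 3 / sqrt 30"
  then have eq: "x $ i = 3 * (1 / sqrt 30)" and xA: "x \<in> A3 C"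
    using assms(2) by (simp_all add: lobe_def)
  obtain k where "x $ k > 3 * (1 / sqrt 30)"
    using exists_large_coordinate(2)[OF xA inverse_sqrt_30(1,2)] assms(1) by auto
  then show False
    using not_two_coordinates_above[OF xA inverse_sqrt_30(1,2), of k i] eq by (cases "k = i") auto
qed

lemma lobes_disjoint:
  assumes "1 / sqrt 30 < C" "i \<noteq> j"
  shows "lobe C i \<inter> lobe C j = {}"
proof -
  have "x \<notin> lobe C j" if "x \<in> lobe C i" for x
    using that lobe_strict[OF assms(1) that]
      not_two_coordinates_above[OF _ inverse_sqrt_30(1,2) assms(2), of x C]
    by (auto simp: lobe_def)
  then show ?thesis by blast
qed

text \<open>No point of a lobe lies on the threshold, so the strict inequality cuts out the same
  set.\<close>

lemma openin_lobe:
  assumes "1 / sqrt 30 < C"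
  shows "openin (top_of_set (A3 C)) (lobe C i)"
proof -
  have "lobe C i = A3 C \<inter> {x. x $ i > 3 / sqrt 30}"
    using lobe_strict[OF assms] by (auto simp: lobe_def)
  moreover have "open {x :: real ^ 5. x $ i > 3 / sqrt 30}"
    by (intro open_Collect_less continuous_intros)
  ultimately show ?thesis by (auto simp: openin_open)
qed

lemma lobes_inter_singleton:
  assumes "i \<noteq> j"
  shows "lobe (1 / sqrt 30) i \<inter> lobe (1 / sqrt 30) j = {two_valued (1 / sqrt 30) {i, j}}"
  using two_coordinates_ge_iff[OF inverse_sqrt_30(1,2) assms]
  unfolding lobe_def inverse_sqrt_30(3) by blast

lemma bij_betw_of_nat_5: "bij_betw of_nat {..<5} (UNIV :: 5 set)"
proof -
  have "{..<5 :: nat} = {0, 1, 2, 3, 4}" by auto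
  then have "of_nat ` {..<5} = (UNIV :: 5 set)"
    unfolding UNIV_5 by simp
  then show ?thesis
    by (simp add: bij_betw_def eq_card_imp_inj_on)
qed

text \<open>The lobes for positive \<open>C\<close>; for negative \<open>C\<close> their images
  under x -> -x, which carries \<open>A3 (- C)\<close> to \<open>A3 C\<close>.\<close>

lemma spheres_disjoint_case:
  assumes "C \<in> {1 / sqrt 30 <..< 3 / sqrt 20} \<union> {- (3 / sqrt 20) <..< - (1 / sqrt 30)}"
  obtains T :: "5 \<Rightarrow> (real ^ 5) set" where "A3 C = (\<Union>i. T i)" "disjoint_family T"
    "\<And>i. openin (top_of_set (A3 C)) (T i)" "\<And>i. diffeomorphic (T i) (sphere (0 :: real ^ 3) 1)"
proof (cases "C > 0")
  case True
  then have C: "1 / sqrt 30 < C" "C < 3 / sqrt 20"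
    using assms inverse_sqrt_30(1) by auto
  show ?thesis
  proof (rule that)
    show "A3 C = (\<Union>i. lobe C i)" using A3_eq_Union_lobes C(1) by simp
    show "disjoint_family (lobe C)" using lobes_disjoint[OF C(1)] by (simp add: disjoint_family_on_def)
  qed (use openin_lobe lobe_diffeomorphic_sphere C in auto)
next
  case False
  have "3 / sqrt 20 > 0" by simp
  with False have C: "1 / sqrt 30 < - C" "- C < 3 / sqrt 20"
    using assms inverse_sqrt_30(1) by auto
  have neg: "A3 C = uminus ` A3 (- C)" using A3_uminus[of "- C"] by simp
  show ?thesis
  proof (rule that)
    show "A3 C = (\<Union>i. uminus ` lobe (- C) i)"
      unfolding neg using A3_eq_Union_lobes[of "- C"] C(1) by auto
    show "disjoint_family (\<lambda>i. uminus ` lobe (- C) i)"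
      using lobes_disjoint[OF C(1)] by (fastforce simp: disjoint_family_on_def)
    show "openin (top_of_set (A3 C)) (uminus ` lobe (- C) i)" for i
    proof -
      obtain O' where O': "open O'" "lobe (- C) i = A3 (- C) \<inter> O'"
        using openin_lobe[OF C(1), of i] unfolding openin_open by blast
      then have "uminus ` lobe (- C) i = A3 C \<inter> uminus ` O'"
        unfolding neg by (simp add: image_Int)
      then show ?thesis
        using open_negations[OF O'(1)] unfolding openin_open by blast
    qed
    show "diffeomorphic (uminus ` lobe (- C) i) (sphere (0 :: real ^ 3) 1)" for i
    proof (rule diffeomorphic_trans[OF diffeomorphic_sym lobe_diffeomorphic_sphere[OF C]])
      show "diffeomorphic (lobe (- C) i) (uminus ` lobe (- C) i)"
        by (rule diffeomorphic_linear_image[where g = uminus]) (auto intro: bounded_linear_minus bounded_linear_ident)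
    qed
  qed
qed

text \<open>Lobes i and j share only the \<open>two_valued\<close> point of {i, j}; for negative
  \<open>C\<close> everything is reflected in the origin.\<close>

lemma spheres_touching_case:
  assumes "C = 1 / sqrt 30 \<or> C = - (1 / sqrt 30)"
  obtains T :: "5 \<Rightarrow> (real ^ 5) set" where "A3 C = (\<Union>i. T i)"
    "\<And>i. T i homeomorphic sphere (0 :: real ^ 3) 1" "\<And>i j. i \<noteq> j \<Longrightarrow> \<exists>!p. p \<in> T i \<inter> T j"
proof -
  let ?c = "1 / sqrt 30"
  have lt: "?c < 3 / sqrt 20"
  proof -
    have "sqrt 20 < sqrt 30" by simp
    also have "\<dots> < 3 * sqrt 30" by simp
    finally show ?thesis by (simp add: field_simps)
  qed
  have A3: "A3 ?c = (\<Union>i. lobe ?c i)" using A3_eq_Union_lobes by blast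
  have hom: "lobe ?c i homeomorphic sphere (0 :: real ^ 3) 1" for i
    using lobe_homeomorphic_sphere[OF _ lt] by blast
  show ?thesis
  proof (cases "C = ?c")
    case True
    show ?thesis
    proof (rule that)
      show "A3 C = (\<Union>i. lobe ?c i)" unfolding True by (rule A3)
      show "\<exists>!p. p \<in> lobe ?c i \<inter> lobe ?c j" if "i \<noteq> j" for i j
        unfolding lobes_inter_singleton[OF that] by simp
    qed (rule hom)
  next
    case False
    then have neg: "A3 C = uminus ` A3 ?c" using assms A3_uminus[of ?c] by simp
    show ?thesis
    proof (rule that)
      show "A3 C = (\<Union>i. uminus ` lobe ?c i)" unfolding neg A3 by auto
      show "uminus ` lobe ?c i homeomorphic sphere (0 :: real ^ 3) 1" for i
      proof (rule homeomorphic_trans[OF homeomorphic_sym[THEN iffD1] hom])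
        show "lobe ?c i homeomorphic uminus ` lobe ?c i"
          by (rule homeomorphic_compact[OF compact_lobe _ refl]) (auto intro!: continuous_intros)
      qed
      show "\<exists>!p. p \<in> uminus ` lobe ?c i \<inter> uminus ` lobe ?c j" if "i \<noteq> j" for i j
        unfolding image_Int[OF inj_uminus, symmetric] lobes_inter_singleton[OF that] by simp
    qed
  qed
qed

theorem mainTheorem3:
  fixes C :: real
  shows
    "(C \<in> {1 / sqrt 30 <..< 3 / sqrt 20} \<union> {- (3 / sqrt 20) <..< - (1 / sqrt 30)} \<longrightarrow>
        smooth_submanifold TYPE(real ^ 2) (A3 C) \<and>
        (\<exists>S :: nat \<Rightarrow> (real ^ 5) set.
           A3 C = (\<Union>i<5. S i) \<and> disjoint_family_on S {..<5} \<and>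
           (\<forall>i<5. openin (top_of_set (A3 C)) (S i) \<and>
                  diffeomorphic (S i) (sphere (0 :: real ^ 3) 1)))) \<and>
     (C = 1 / sqrt 30 \<or> C = - (1 / sqrt 30) \<longrightarrow>
        (\<exists>S :: nat \<Rightarrow> (real ^ 5) set.
           A3 C = (\<Union>i<5. S i) \<and>
           (\<forall>i<5. S i homeomorphic sphere (0 :: real ^ 3) 1) \<and>
           (\<forall>i<5. \<forall>j<5. i \<noteq> j \<longrightarrow> (\<exists>!p. p \<in> S i \<inter> S j))) \<and>
        card (singular_points C) = 5 choose 2 \<and> (5 choose 2 :: nat) = 10)"
proof (intro conjI impI)
  \<comment> \<open>The spheres were indexed by the coordinates, of type \<open>5\<close>;
    \<open>of_nat\<close> renumbers them by the naturals below 5.\<close>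
  have img: "of_nat ` {..<5} = (UNIV :: 5 set)" and inj: "inj_on (of_nat :: nat \<Rightarrow> 5) {..<5}"
    using bij_betw_of_nat_5 by (simp_all add: bij_betw_def)
  have UN: "(\<Union>i. T i) = (\<Union>n<5. T (of_nat n))" for T :: "5 \<Rightarrow> (real ^ 5) set"
    unfolding img[symmetric] by simp
  have neq: "of_nat m \<noteq> (of_nat n :: 5)" if "m < 5" "n < 5" "m \<noteq> n" for m n :: nat
    using that inj_onD[OF inj, of m n] by auto
  {
    assume "C \<in> {1 / sqrt 30 <..< 3 / sqrt 20} \<union> {- (3 / sqrt 20) <..< - (1 / sqrt 30)}"
    then obtain T :: "5 \<Rightarrow> (real ^ 5) set" where T: "A3 C = (\<Union>i. T i)" "disjoint_family T"
      "\<And>i. openin (top_of_set (A3 C)) (T i)" "\<And>i. diffeomorphic (T i) (sphere (0 :: real ^ 3) 1)"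
      using spheres_disjoint_case by blast
    show "smooth_submanifold TYPE(real ^ 2) (A3 C)"
      by (rule smooth_submanifold_if_locally_sphere) (use T in blast)
    show "\<exists>S :: nat \<Rightarrow> (real ^ 5) set.
           A3 C = (\<Union>i<5. S i) \<and> disjoint_family_on S {..<5} \<and>
           (\<forall>i<5. openin (top_of_set (A3 C)) (S i) \<and>
                  diffeomorphic (S i) (sphere (0 :: real ^ 3) 1))"
    proof (intro exI[of _ "\<lambda>n. T (of_nat n)"] conjI allI impI T(3,4))
      show "A3 C = (\<Union>n<5. T (of_nat n))" using T(1) UN by simp
      show "disjoint_family_on (\<lambda>n. T (of_nat n)) {..<5}"
        using T(2) neq by (simp add: disjoint_family_on_def)
    qed
  }
  assume C: "C = 1 / sqrt 30 \<or> C = - (1 / sqrt 30)"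
  then obtain T :: "5 \<Rightarrow> (real ^ 5) set" where T: "A3 C = (\<Union>i. T i)"
    "\<And>i. T i homeomorphic sphere (0 :: real ^ 3) 1" "\<And>i j. i \<noteq> j \<Longrightarrow> \<exists>!p. p \<in> T i \<inter> T j"
    using spheres_touching_case by blast
  show "\<exists>S :: nat \<Rightarrow> (real ^ 5) set.
           A3 C = (\<Union>i<5. S i) \<and>
           (\<forall>i<5. S i homeomorphic sphere (0 :: real ^ 3) 1) \<and>
           (\<forall>i<5. \<forall>j<5. i \<noteq> j \<longrightarrow> (\<exists>!p. p \<in> S i \<inter> S j))"
  proof (intro exI[of _ "\<lambda>n. T (of_nat n)"] conjI allI impI T(2,3) neq)
    show "A3 C = (\<Union>n<5. T (of_nat n))" using T(1) UN by simp
  qed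
  show "card (singular_points C) = 5 choose 2"
    using C inverse_sqrt_30(2) by (intro card_singular_points) auto
  show "(5 choose 2 :: nat) = 10"
    by (simp add: eval_nat_numeral)
qed

end
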